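(* (ZFC + AT) The boolean algebras $\mathcal{B}_n$, $n\geq 1$, are pairwise non-isomorphic; in fact $\mathcal{B}_m$ is not isomorphic to a subalgebra of $\mathcal{B}_n$ whenever $m>n\geq 1$.
   Context: For $k\ge1$, $I_{\omega^k}=\{P\subseteq\omega^k\mid \mathrm{o.t.}(P)<\omega^k\}$ ($\mathrm{o.t.}$ = order type as a suborder of $(\omega^k,<)$) and $\mathcal{B}_k=(\mathcal{P}(\omega^k)/I_{\omega^k},\cap,\cup,\neg,\mathbf{0},\mathbf{1})$. (Each $\mathcal{B}_k$ is $\omega^k$-automatic.) Subsets of a countable set $A$ are identified with points of the Cantor space $2^A$, which gives meaning to continuity and to ${\bf\Sigma}^1_1$ (analytic) families. For countable infinite $A,B$, a function $H:\mathcal{P}(A)\to\mathcal{P}(B)$ and an ideal $I\subseteq\mathcal{P}(B)$ containing all finite sets but not $B$, $H$ preserves intersections modulo $I$ if $H(X)\triangle H(Y)\in I$ whenever $X\triangle Y$ is finite, and $H(X\cap Y)\triangle(H(X)\cap H(Y))\in I$ for all $X,Y\subseteq A$. Sets are almost disjoint if their intersection is finite. Axiom AT (Just): for every ${\bf\Sigma}^1_1$-ideal $I$ of subsets of $\omega$, every $H:\mathcal{P}(\omega)\to\mathcal{P}(\omega)$ preserving intersections modulo $I$, and every uncountable family $\mathcal{A}$ of pairwise almost disjoint infinite subsets of $\omega$, there are $A\in\mathcal{A}$ and a finite decomposition $A=\bigcup_{i<k}A_i$ such that for each $i<k$ there is a continuous $F_i:\mathcal{P}(A_i)\to\mathcal{P}(\omega)$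 with $F_i(X)\triangle H(X)\in I$ for all $X\subseteq A_i$. *)

theory Defs
  imports "HOL-Analysis.Analysis"
begin

text \<open>
  The ordinal \<open>\<omega>\<^sup>k\<close> is represented by its Cantor normal forms: the list
  \<open>[c\<^sub>1, \<dots>, c\<^sub>k]\<close> stands for \<open>\<omega>\<^bsup>k-1\<^esup> c\<^sub>1 + \<dots> + \<omega> c\<^sub>k\<^sub>-\<^sub>1 + c\<^sub>k\<close>, so that the ordering is the
  lexicographic one with the first entry most significant.
\<close>

definition omega_pow :: "nat \<Rightarrow> nat list rel" where
  "omega_pow k = {(xs, ys). length xs = k \<and> length ys = k \<and> (xs = ys \<or> (xs, ys) \<in> lexn less_than k)}"

lemma Field_omega_pow: "Field (omega_pow k) = {xs. length xs = k}"
  by (auto simp: Field_def omega_pow_def)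

lemma Well_order_omega_pow: "Well_order (omega_pow k)"
proof -
  have wf: "wf (lexn less_than k)" by (simp add: wf_lexn)
  have irr: "(xs, xs) \<notin> lexn less_than k" for xs
    using wf by (meson wf_not_refl)
  have asy: "(ys, xs) \<notin> lexn less_than k" if "(xs, ys) \<in> lexn less_than k" for xs ys
    using wf that by (meson wf_not_sym)
  have trans: "trans (lexn less_than k)" by (simp add: lexn_transI)
  have tot: "xs = ys \<or> (xs, ys) \<in> lexn less_than k \<or> (ys, xs) \<in> lexn less_than k"
    if "length xs = k" "length ys = k" for xs ys
    using that
  proof (induction k arbitrary: xs ys)
    case (Suc k)
    then obtain x xs' y ys' where "xs = x # xs'" "ys = y # ys'" "length xs' = k" "length ys' = k"
      by (metis length_Suc_conv)
    moreover have "(a # as, b # bs) \<in> lexn less_than (Suc k)"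
      if "a < b \<or> a = b \<and> (as, bs) \<in> lexn less_than k" "length as = k" "length bs = k" for a b as bs
      using that by (auto simp: image_iff intro!: bexI[of _ "((a, as), (b, bs))"])
    ultimately show ?case
      using Suc.IH[of xs' ys'] by (metis nat_neq_iff)
  qed simp
  have "omega_pow k - Id = lexn less_than k"
    using irr by (auto simp: omega_pow_def dest: lexn_length)
  moreover have "Refl (omega_pow k)"
    unfolding refl_on_def Field_omega_pow by (auto simp: omega_pow_def)
  moreover have "Relation.trans (omega_pow k)"
    using trans unfolding omega_pow_def trans_def by blast
  moreover have "antisym (omega_pow k)"
    using asy by (auto simp: antisym_def omega_pow_def)
  moreover have "Total (omega_pow k)"
    using tot unfolding total_on_def Field_omega_pow by (auto simp: omega_pow_def)
  moreover have "omega_pow k \<subseteq> Field (omega_pow k) \<times> Field (omega_pow k)"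
    by (auto simp: Field_def)
  ultimately show ?thesis
    using wf by (simp add: well_order_on_def linear_order_on_def partial_order_on_def preorder_on_def)
qed

lemma Field_Restr_omega_pow:
  "P \<subseteq> Field (omega_pow k) \<Longrightarrow> Field (Restr (omega_pow k) P) = P"
  using Well_order_omega_pow by (simp add: Refl_Field_Restr2 order_on_defs)

definition small_ideal :: "nat \<Rightarrow> nat list set set" where
  "small_ideal k = {P. P \<subseteq> Field (omega_pow k) \<and> (Restr (omega_pow k) P, omega_pow k) \<in> ordLess}"

record 'a balg =
  bcarrier :: "'a set"
  bmeet :: "'a \<Rightarrow> 'a \<Rightarrow> 'a"
  bjoin :: "'a \<Rightarrow> 'a \<Rightarrow> 'a"
  bcompl :: "'a \<Rightarrow> 'a"
  bzero :: "'a"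
  bone :: "'a"

definition balg_isomorphic :: "'a balg \<Rightarrow> 'b balg \<Rightarrow> bool" where
  "balg_isomorphic A B \<longleftrightarrow> (\<exists>f.
     bij_betw f (bcarrier A) (bcarrier B) \<and>
     (\<forall>x\<in>bcarrier A. \<forall>y\<in>bcarrier A. f (bmeet A x y) = bmeet B (f x) (f y)) \<and>
     (\<forall>x\<in>bcarrier A. \<forall>y\<in>bcarrier A. f (bjoin A x y) = bjoin B (f x) (f y)) \<and>
     (\<forall>x\<in>bcarrier A. f (bcompl A x) = bcompl B (f x)) \<and>
     f (bzero A) = bzero B \<and> f (bone A) = bone B)"

definition balg_subuniverse :: "'a set \<Rightarrow> 'a balg \<Rightarrow> bool" where
  "balg_subuniverse S B \<longleftrightarrow>
     S \<subseteq> bcarrier B \<and> bzero B \<in> S \<and> bone B \<in> S \<and>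
     (\<forall>x\<in>S. \<forall>y\<in>S. bmeet B x y \<in> S \<and> bjoin B x y \<in> S) \<and>
     (\<forall>x\<in>S. bcompl B x \<in> S)"

definition balg_isomorphic_to_subalgebra :: "'a balg \<Rightarrow> 'b balg \<Rightarrow> bool" where
  "balg_isomorphic_to_subalgebra A B \<longleftrightarrow>
     (\<exists>S. balg_subuniverse S B \<and> balg_isomorphic A (B\<lparr>bcarrier := S\<rparr>))"

definition ideal_equiv :: "'a set \<Rightarrow> 'a set set \<Rightarrow> 'a set rel" where
  "ideal_equiv U I = {(X, Y). X \<subseteq> U \<and> Y \<subseteq> U \<and> sym_diff X Y \<in> I}"

definition power_quotient :: "'a set \<Rightarrow> 'a set set \<Rightarrow> 'a set set balg" where
  "power_quotient U I = (let E = ideal_equiv U I in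
     \<lparr> bcarrier = Pow U // E,
       bmeet = (\<lambda>a b. \<Union>X\<in>a. \<Union>Y\<in>b. E `` {X \<inter> Y}),
       bjoin = (\<lambda>a b. \<Union>X\<in>a. \<Union>Y\<in>b. E `` {X \<union> Y}),
       bcompl = (\<lambda>a. \<Union>X\<in>a. E `` {U - X}),
       bzero = E `` {{}},
       bone = E `` {U} \<rparr>)"

definition ord_balg :: "nat \<Rightarrow> nat list set set balg" where
  "ord_balg k = power_quotient (Field (omega_pow k)) (small_ideal k)"

definition powerset_topology :: "'a set \<Rightarrow> 'a set topology" where
  "powerset_topology A =
     pullback_topology (Pow A) (\<lambda>X. \<lambda>a\<in>A. a \<in> X)
       (product_topology (\<lambda>_. discrete_topology (UNIV :: bool set)) A)"

lemma topspace_powerset_topology [simp]: "topspace (powerset_topology A) = Pow A"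
  by (auto simp: powerset_topology_def topspace_pullback_topology)

text \<open>Boldface \<open>\<Sigma>\<^sup>1\<^sub>1\<close>: projections of closed subsets of the product with Baire space.\<close>

definition Sigma11_in :: "'a topology \<Rightarrow> 'a set \<Rightarrow> bool" where
  "Sigma11_in T S \<longleftrightarrow>
     (\<exists>C. closedin (prod_topology T
              (product_topology (\<lambda>_. discrete_topology (UNIV :: nat set)) (UNIV :: nat set))) C \<and>
          S = fst ` C)"

text \<open>All ideals are proper and contain the finite sets.\<close>

definition set_ideal :: "'a set \<Rightarrow> 'a set set \<Rightarrow> bool" where
  "set_ideal B I \<longleftrightarrow>
     I \<subseteq> Pow B \<and>
     (\<forall>X\<in>I. \<forall>Y. Y \<subseteq> X \<longrightarrow> Y \<in> I) \<and>
     (\<forall>X\<in>I. \<forall>Y\<in>I. X \<union> Y \<in> I) \<and>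
     (\<forall>X. X \<subseteq> B \<and> finite X \<longrightarrow> X \<in> I) \<and>
     B \<notin> I"

definition preserves_inter_mod ::
  "'a set \<Rightarrow> 'b set \<Rightarrow> 'b set set \<Rightarrow> ('a set \<Rightarrow> 'b set) \<Rightarrow> bool" where
  "preserves_inter_mod A B I H \<longleftrightarrow>
     H \<in> Pow A \<rightarrow> Pow B \<and>
     (\<forall>X Y. X \<subseteq> A \<and> Y \<subseteq> A \<and> finite (sym_diff X Y) \<longrightarrow> sym_diff (H X) (H Y) \<in> I) \<and>
     (\<forall>X Y. X \<subseteq> A \<and> Y \<subseteq> A \<longrightarrow> sym_diff (H (X \<inter> Y)) (H X \<inter> H Y) \<in> I)"

definition axiom_AT :: bool where
  "axiom_AT \<longleftrightarrow>
     (\<forall>(I :: nat set set) (H :: nat set \<Rightarrow> nat set) (\<A> :: nat set set).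
        set_ideal UNIV I \<and> Sigma11_in (powerset_topology UNIV) I \<and>
        preserves_inter_mod UNIV UNIV I H \<and>
        uncountable \<A> \<and> (\<forall>A\<in>\<A>. infinite A) \<and> pairwise (\<lambda>A B. finite (A \<inter> B)) \<A> \<longrightarrow>
        (\<exists>A\<in>\<A>. \<exists>(k :: nat) (P :: nat \<Rightarrow> nat set).
           A = (\<Union>i<k. P i) \<and>
           (\<forall>i<k. \<exists>F. continuous_map (powerset_topology (P i)) (powerset_topology UNIV) F \<and>
                      (\<forall>X. X \<subseteq> P i \<longrightarrow> sym_diff (F X) (H X) \<in> I))))"

end

theory Submission
  imports Defs
begin

text \<open>
  A subset of \<open>\<omega>\<^sup>k\<close> has order type \<open>\<omega>\<^sup>k\<close> iff it is positive, i.e. iff it satisfies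
  \<open>\<exists>\<^sup>\<infinity>c\<^sub>1 \<dots> \<exists>\<^sup>\<infinity>c\<^sub>k. [c\<^sub>1, \<dots>, c\<^sub>k] \<in> X\<close>. Suppose that an embedding of the \<open>m\<close>-th algebra into the
  \<open>n\<close>-th is given, \<open>m > n\<close>, and choose a lifting \<open>H\<close>. If \<open>D\<close> runs through an uncountable almost
  disjoint family, then so do the sets of lists of length \<open>m\<close> over \<open>D\<close>, and all of these are
  positive; AT therefore yields a positive set \<open>P\<close> and a continuous \<open>F\<close> on its subsets such that \<open>X\<close>
  is positive iff \<open>F X\<close> is.

  Let \<open>C\<^sub>k\<close> be the class of \<open>k\<close>-fold iterated upper limits of clopen subsets of the Cantor space, i.e. of
  the continuous preimages of the family of positive sets. Then \<open>F\<close> gives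
  \<open>C\<^sub>n\<^sub>+\<^sub>1 \<subseteq> C\<^sub>m \<subseteq> C\<^sub>n\<close>, so \<open>C\<^sub>n\<close> is closed under upper limits of sequences. A family of sets that contains
  the clopen sets and is closed under upper limits contains all Borel sets. But \<open>C\<^sub>n\<close> has a universal
  set, and its antidiagonal is a Borel set outside \<open>C\<^sub>n\<close>.
\<close>

section \<open>Iterated infinity quantifiers on sets of lists\<close>

primrec positive :: "nat \<Rightarrow> nat list set \<Rightarrow> bool" where
  "positive 0 X \<longleftrightarrow> [] \<in> X"
| "positive (Suc k) X \<longleftrightarrow> (\<exists>\<^sub>\<infinity>c. positive k {s. c # s \<in> X})"

lemma positive_mono: "positive k X \<Longrightarrow> (\<And>s. s \<in> X \<Longrightarrow> length s = k \<Longrightarrow> s \<in> Y) \<Longrightarrow> positive k Y"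
proof (induction k arbitrary: X Y)
  case (Suc k)
  have "positive k {s. c # s \<in> Y}" if "positive k {s. c # s \<in> X}" for c
    using Suc.IH[OF that, of "{s. c # s \<in> Y}"] Suc.prems(2) by auto
  then show ?case using Suc.prems(1) by (auto elim!: INFM_mono)
qed simp

lemma positive_Un: "positive k (X \<union> Y) \<longleftrightarrow> positive k X \<or> positive k Y"
proof (induction k arbitrary: X Y)
  case (Suc k)
  have "{s. c # s \<in> X \<union> Y} = {s. c # s \<in> X} \<union> {s. c # s \<in> Y}" for c by auto
  then show ?case by (simp add: Suc.IH INFM_disj_distrib del: Un_iff)
qed simp

lemma positive_UNIV [simp]: "positive k UNIV"
  by (induction k) auto

lemma not_positive_empty [simp]: "\<not> positive k {}"
  by (induction k) auto

lemma positive_lists: "infinite A \<Longrightarrow> positive k {s. set s \<subseteq> A}"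
proof (induction k)
  case (Suc k)
  have "{c. positive k {s. set (c # s) \<subseteq> A}} \<supseteq> A" using Suc by auto
  then show ?case using Suc.prems by (auto simp: INFM_iff_infinite dest: finite_subset)
qed simp

text \<open>The non-positive sets form an ideal, so one piece of a finite decomposition stays
  positive. This selects the piece on which AT supplies a useful continuous map.\<close>

lemma positive_UN:
  fixes N :: nat
  assumes "positive k (\<Union>i<N. X i)"
  shows "\<exists>i<N. positive k (X i)"
  using assms
proof (induction N)
  case (Suc N)
  then show ?case by (auto simp: lessThan_Suc positive_Un less_Suc_eq)
qed simp

lemma positive_sym_diff:
  assumes "\<not> positive k (sym_diff X Y)"
  shows "positive k X \<longleftrightarrow> positive k Y"
proof -
  have "X \<subseteq> Y \<union> sym_diff X Y" "Y \<subseteq> X \<union> sym_diff X Y" by auto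
  then show ?thesis using assms positive_mono positive_Un by (metis subsetD)
qed

text \<open>Only finitely many heads occur in a finite set, so almost all sections are empty. The
  bound on \<open>k\<close> matters: \<open>{[]}\<close> is positive for
  \<open>k = 0\<close>.\<close>

lemma finite_imp_not_positive:
  assumes "finite X" "k \<ge> 1"
  shows "\<not> positive k X"
proof
  assume p: "positive k X"
  obtain j where k: "k = Suc j" using assms by (cases k) auto
  have "{c. positive j {s. c # s \<in> X}} \<subseteq> hd ` X"
  proof
    fix c assume "c \<in> {c. positive j {s. c # s \<in> X}}"
    then have "{s. c # s \<in> X} \<noteq> {}" by (metis (mono_tags) mem_Collect_eq not_positive_empty)
    then show "c \<in> hd ` X" by force
  qed
  then show False using p assms(1) unfolding k by (auto simp: INFM_iff_infinite dest: finite_subset)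
qed

text \<open>The Skolem function \<open>w\<close> witnesses all the quantifiers \<open>\<exists>N. \<forall>c\<ge>N\<close> in the negation.\<close>

lemma not_positive_iff_witness:
  "\<not> positive k X \<longleftrightarrow> (\<exists>w. \<forall>s\<in>X. length s = k \<longrightarrow> (\<exists>i<k. s ! i < w (take i s)))"
proof (induction k arbitrary: X)
  case (Suc k)
  show ?case
  proof
    assume "\<not> positive (Suc k) X"
    then obtain N where N: "\<And>c. c \<ge> N \<Longrightarrow> \<not> positive k {s. c # s \<in> X}"
      by (auto simp: INFM_nat_le)
    then have "\<forall>c. \<exists>w. c \<ge> N \<longrightarrow> (\<forall>s\<in>{s. c # s \<in> X}. length s = k \<longrightarrow> (\<exists>i<k. s ! i < w (take i s)))"
      using Suc.IH by meson
    then obtain W where W: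
      "\<And>c s. c \<ge> N \<Longrightarrow> c # s \<in> X \<Longrightarrow> length s = k \<Longrightarrow> \<exists>i<k. s ! i < W c (take i s)"
      by (metis mem_Collect_eq)
    define w where "w s = (case s of [] \<Rightarrow> N | c # s' \<Rightarrow> W c s')" for s
    have "\<exists>i<Suc k. s ! i < w (take i s)" if s: "s \<in> X" "length s = Suc k" for s
    proof -
      obtain c s' where cs: "s = c # s'" "length s' = k" using s by (cases s) auto
      show ?thesis
      proof (cases "c < N")
        case True
        then show ?thesis using cs by (intro exI[of _ 0]) (auto simp: w_def)
      next
        case False
        then obtain i where "i < k" "s' ! i < W c (take i s')" using W[of c s'] s cs by auto
        then show ?thesis using cs by (intro exI[of _ "Suc i"]) (auto simp: w_def)
      qed
    qed
    then show "\<exists>w. \<forall>s\<in>X. length s = Suc k \<longrightarrow> (\<exists>i<Suc k. s ! i < w (take i s))" by blast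
  next
    assume "\<exists>w. \<forall>s\<in>X. length s = Suc k \<longrightarrow> (\<exists>i<Suc k. s ! i < w (take i s))"
    then obtain w where w: "\<And>s. s \<in> X \<Longrightarrow> length s = Suc k \<Longrightarrow> \<exists>i<Suc k. s ! i < w (take i s)" by blast
    have "\<not> positive k {s. c # s \<in> X}" if "c \<ge> w []" for c
      unfolding Suc.IH
    proof (intro exI[of _ "\<lambda>s. w (c # s)"] ballI impI)
      fix s assume "s \<in> {s. c # s \<in> X}" "length s = k"
      then obtain i where "i < Suc k" "(c # s) ! i < w (take i (c # s))" using w[of "c # s"] by auto
      then show "\<exists>i<k. s ! i < w (c # take i s)" using that by (cases i) auto
    qed
    then show "\<not> positive (Suc k) X" by (auto simp: INFM_nat_le)
  qed
qed auto

subsection \<open>Positivity and order type\<close>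

lemma lexn_Cons_iff:
  "(x # xs, y # ys) \<in> lexn less_than (Suc k) \<longleftrightarrow>
     length xs = k \<and> length ys = k \<and> (x < y \<or> x = y \<and> (xs, ys) \<in> lexn less_than k)"
proof
  assume "(x # xs, y # ys) \<in> lexn less_than (Suc k)"
  then show "length xs = k \<and> length ys = k \<and> (x < y \<or> x = y \<and> (xs, ys) \<in> lexn less_than k)"
    by auto
next
  assume "length xs = k \<and> length ys = k \<and> (x < y \<or> x = y \<and> (xs, ys) \<in> lexn less_than k)"
  then show "(x # xs, y # ys) \<in> lexn less_than (Suc k)"
    by (auto simp: image_iff intro!: bexI[of _ "((x, xs), (y, ys))"])
qed

declare lexn.simps(2) [simp del]

lemma lexn_trans: "(x, y) \<in> lexn less_than k \<Longrightarrow> (y, z) \<in> lexn less_than k \<Longrightarrow> (x, z) \<in> lexn less_than k"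
  using lexn_transI[of less_than k] by (auto dest: transD)

lemma lexn_irrefl: "(x, x) \<notin> lexn less_than k"
  using wf_lexn[OF wf_less_than] by (meson wf_not_refl)

lemma lexn_total:
  assumes "length x = k" "length y = k"
  shows "x = y \<or> (x, y) \<in> lexn less_than k \<or> (y, x) \<in> lexn less_than k"
  using Well_order_omega_pow[of k] assms
  unfolding well_order_on_def linear_order_on_def total_on_def Field_omega_pow
  by (auto simp: omega_pow_def)

text \<open>As the order is total, these are the order embeddings of \<open>\<omega>\<^sup>k\<close>
  into itself; lists of any other length are left unconstrained. Positive sets turn out to be those
  containing the image of such a map.\<close>

definition lex_mono :: "nat \<Rightarrow> (nat list \<Rightarrow> nat list) \<Rightarrow> bool" where
  "lex_mono k g \<longleftrightarrow> (\<forall>s. length s = k \<longrightarrow> length (g s) = k) \<and>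
     (\<forall>s t. (s, t) \<in> lexn less_than k \<longrightarrow> (g s, g t) \<in> lexn less_than k)"

text \<open>A least \<open>s\<close> that is moved down would make \<open>g s\<close> a smaller
  one.\<close>

lemma lex_mono_not_decreasing:
  assumes "lex_mono k g"
  shows "(g s, s) \<notin> lexn less_than k"
proof (induction s rule: wf_induct_rule[OF wf_lexn[OF wf_less_than, of k]])
  case (1 s)
  show ?case
  proof
    assume lt: "(g s, s) \<in> lexn less_than k"
    then have "(g (g s), g s) \<in> lexn less_than k" using assms by (simp add: lex_mono_def)
    then show False using 1[OF lt] by simp
  qed
qed

lemma lex_mono_reflects:
  assumes "lex_mono k g" "length s = k" "length t = k" "(g s, g t) \<in> lexn less_than k"
  shows "(s, t) \<in> lexn less_than k"
  using lexn_total[OF assms(2,3)]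
proof (elim disjE)
  assume "(t, s) \<in> lexn less_than k"
  then have "(g t, g s) \<in> lexn less_than k" using assms(1) by (simp add: lex_mono_def)
  then show ?thesis using lexn_trans[OF assms(4)] lexn_irrefl by fast
qed (use assms(4) lexn_irrefl in auto)

lemma lex_mono_inj:
  assumes g: "lex_mono k g"
  shows "inj_on g {s. length s = k}"
proof (rule inj_onI)
  fix s t assume st: "s \<in> {s. length s = k}" "t \<in> {s. length s = k}" "g s = g t"
  then have "(s, t) \<notin> lexn less_than k" "(t, s) \<notin> lexn less_than k"
    using g lexn_irrefl[of "g s"] unfolding lex_mono_def by metis+
  then show "s = t" using lexn_total st by blast
qed

text \<open>The blocks with fixed first entry are sent, in increasing order, to the infinitely many
  heads whose section is positive; inside each block the induction hypothesis provides the
  embedding.\<close>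

lemma positive_imp_lex_mono:
  "positive k P \<Longrightarrow> \<exists>g. lex_mono k g \<and> (\<forall>s. length s = k \<longrightarrow> g s \<in> P)"
proof (induction k arbitrary: P)
  case 0
  then show ?case by (intro exI[of _ id]) (auto simp: lex_mono_def)
next
  case (Suc k)
  define D where "D = {c. positive k {s. c # s \<in> P}}"
  have "infinite D" using Suc.prems by (simp add: D_def INFM_iff_infinite)
  then obtain r :: "nat \<Rightarrow> nat" where r: "strict_mono r" "\<And>n. r n \<in> D"
    using infinite_enumerate by blast
  have "\<forall>c. \<exists>h. c \<in> D \<longrightarrow> lex_mono k h \<and> (\<forall>s. length s = k \<longrightarrow> c # h s \<in> P)"
    using Suc.IH unfolding D_def by fastforce
  then obtain h where h: "\<And>c. c \<in> D \<Longrightarrow> lex_mono k (h c)"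
    "\<And>c s. c \<in> D \<Longrightarrow> length s = k \<Longrightarrow> c # h c s \<in> P" by metis
  define g where "g s = r (hd s) # h (r (hd s)) (tl s)" for s
  have "lex_mono (Suc k) g"
    unfolding lex_mono_def
  proof (intro conjI allI impI)
    fix s :: "nat list" assume "length s = Suc k"
    then show "length (g s) = Suc k" using h(1)[OF r(2)] by (simp add: g_def lex_mono_def)
  next
    fix s t :: "nat list" assume st: "(s, t) \<in> lexn less_than (Suc k)"
    then have "length s = Suc k" "length t = Suc k" by (auto dest: lexn_length)
    then obtain x xs y ys where xy: "s = x # xs" "t = y # ys" by (metis length_Suc_conv)
    show "(g s, g t) \<in> lexn less_than (Suc k)"
      using st h(1)[OF r(2)] r(1) unfolding xy lexn_Cons_iff g_def
      by (auto simp: lex_mono_def strict_mono_less)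
  qed
  moreover have "g s \<in> P" if "length s = Suc k" for s
    using that h(2)[OF r(2)] by (simp add: g_def)
  ultimately show ?case by blast
qed

lemma lex_mono_imp_positive:
  "lex_mono k g \<Longrightarrow> (\<And>s. length s = k \<Longrightarrow> g s \<in> P) \<Longrightarrow> positive k P"
proof (induction k arbitrary: g P)
  case 0
  then show ?case by (force simp: lex_mono_def)
next
  case (Suc k)
  have len: "length (g s) = Suc k" if "length s = Suc k" for s
    using Suc.prems(1) that by (simp add: lex_mono_def)
  have gne: "g (c # t) = hd (g (c # t)) # tl (g (c # t))" "length (tl (g (c # t))) = k"
    if "length t = k" for c t
  proof -
    have "length (g (c # t)) = Suc k" using len that by simp
    then show "g (c # t) = hd (g (c # t)) # tl (g (c # t))" "length (tl (g (c # t))) = k"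
      by (cases "g (c # t)"; simp)+
  qed
  have mono: "hd (g (c # t)) < hd (g (c' # t')) \<or>
      hd (g (c # t)) = hd (g (c' # t')) \<and> (tl (g (c # t)), tl (g (c' # t'))) \<in> lexn less_than k"
    if "c < c' \<or> c = c' \<and> (t, t') \<in> lexn less_than k" "length t = k" "length t' = k" for c c' t t'
  proof -
    have "(g (c # t), g (c' # t')) \<in> lexn less_than (Suc k)"
      using Suc.prems(1) that by (simp add: lex_mono_def lexn_Cons_iff)
    then show ?thesis
      by (subst (asm) gne(1)[OF that(2)], subst (asm) gne(1)[OF that(3)]) (simp add: lexn_Cons_iff)
  qed
  \<comment> \<open>Within one block the first entry of \<open>g\<close> is bounded by its values on the next block,
    hence eventually constant; on the tail where it is constant, \<open>g\<close> embeds a copy of the whole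
    block into a single section.\<close>
  define sh where "sh u t = (case t of [] \<Rightarrow> [] | a # t' \<Rightarrow> (a + hd u + 1) # t')" for u t :: "nat list"
  have sh_len: "length (sh u t) = length t" for u t by (auto simp: sh_def split: list.split)
  \<comment> \<open>Adding \<open>hd u + 1\<close> to the first entry lifts \<open>t\<close>
    strictly above \<open>u\<close>. For \<open>k = 0\<close> both lists are empty, hence the
    alternative \<open>sh u t = u\<close>.\<close>
  have sh_gt: "sh u t = u \<or> (u, sh u t) \<in> lexn less_than k" if "length u = k" "length t = k" for u t
  proof (cases k)
    case (Suc j)
    have "length t = Suc j" "length u = Suc j" using that Suc by auto
    then obtain a t' b u' where "t = a # t'" "u = b # u'" by (metis length_Suc_conv)
    then show ?thesis using that unfolding Suc by (simp add: sh_def lexn_Cons_iff)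
  qed (use that in \<open>auto simp: sh_def\<close>)
  have sh_mono: "(sh u t, sh u t') \<in> lexn less_than k" if "(t, t') \<in> lexn less_than k" for u t t'
  proof (cases k)
    case (Suc j)
    have "length t = Suc j" "length t' = Suc j" using that Suc by (auto dest: lexn_length)
    then obtain a s b s' where "t = a # s" "t' = b # s'" by (metis length_Suc_conv)
    then show ?thesis using that unfolding Suc by (simp add: sh_def lexn_Cons_iff)
  qed (use that in auto)
  have "\<exists>u. length u = k \<and> (\<forall>t. length t = k \<longrightarrow> hd (g (c # t)) \<le> hd (g (c # u)))" for c
  proof -
    let ?S = "{hd (g (c # t)) | t. length t = k}"
    have "?S \<subseteq> {..hd (g (Suc c # replicate k 0))}"
    proof
      fix x assume "x \<in> ?S"
      then obtain t where "x = hd (g (c # t))" "length t = k" by blast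
      then show "x \<in> {..hd (g (Suc c # replicate k 0))}"
        using mono[of c "Suc c" t "replicate k 0"] by auto
    qed
    then have fin: "finite ?S" by (rule finite_subset) simp
    have ne: "?S \<noteq> {}" using length_replicate[of k 0] by blast
    obtain u where u: "length u = k" "Max ?S = hd (g (c # u))" using Max_in[OF fin ne] by auto
    have "hd (g (c # t)) \<le> Max ?S" if "length t = k" for t
      using that by (intro Max_ge[OF fin]) auto
    then show ?thesis using u by auto
  qed
  then obtain u where u: "\<And>c. length (u c) = k"
    "\<And>c t. length t = k \<Longrightarrow> hd (g (c # t)) \<le> hd (g (c # u c))" by metis
  \<comment> \<open>The final value of the first entry on block \<open>c\<close>. These values will
    be the infinitely many heads with positive section.\<close>
  define d where "d c = hd (g (c # u c))" for c
  have d_eq: "hd (g (c # sh (u c) t)) = d c" if "length t = k" for c t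
  proof -
    have "hd (g (c # u c)) \<le> hd (g (c # sh (u c) t))"
      using sh_gt[OF u(1) that, of c]
    proof
      assume "(u c, sh (u c) t) \<in> lexn less_than k"
      then show ?thesis using mono[of c c "u c" "sh (u c) t"] u(1) that sh_len[of "u c" t] by auto
    qed simp
    then show ?thesis using u(2)[of "sh (u c) t" c] that by (simp add: d_def sh_len)
  qed
  \<comment> \<open>Past \<open>u c\<close> the head no longer changes, so the strict increase of
    \<open>g\<close> passes to the tails.\<close>
  define f where "f c t = tl (g (c # sh (u c) t))" for c t
  have f: "lex_mono k (f c)" for c
    unfolding lex_mono_def
  proof (intro conjI allI impI)
    fix s :: "nat list" assume "length s = k"
    then show "length (f c s) = k" using gne(2)[of "sh (u c) s" c] by (simp add: f_def sh_len)
  next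
    fix s t assume st: "(s, t) \<in> lexn less_than k"
    then have l: "length s = k" "length t = k" by (auto dest: lexn_length)
    show "(f c s, f c t) \<in> lexn less_than k"
      using mono[of c c "sh (u c) s" "sh (u c) t"] sh_mono[OF st] d_eq[OF l(1)] d_eq[OF l(2)]
      by (simp add: l sh_len f_def)
  qed
  have pos: "positive k {s. d c # s \<in> P}" for c
  proof (rule Suc.IH[OF f[of c]])
    fix s :: "nat list" assume s: "length s = k"
    have "g (c # sh (u c) s) \<in> P" using Suc.prems(2) s by (simp add: sh_len)
    moreover have "g (c # sh (u c) s) = d c # f c s"
      unfolding f_def d_eq[OF s, symmetric] by (rule gne(1)) (simp add: sh_len s)
    ultimately show "f c s \<in> {s. d c # s \<in> P}" by simp
  qed
  have "d c < d (Suc c)" for c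
  proof -
    have "d c \<le> d (Suc c)" using mono[of c "Suc c" "u c" "u (Suc c)"] u(1) by (auto simp: d_def)
    moreover have "d c \<noteq> d (Suc c)"
    proof
      assume eq: "d c = d (Suc c)"
      \<comment> \<open>If two consecutive blocks ended with the same head, the tail
        \<open>?b\<close> from the later block would lie above every value of \<open>f c\<close>. At
        the argument \<open>?b\<close> itself, the embedding \<open>f c\<close> would then move a
        point down.\<close>
      let ?b = "tl (g (Suc c # u (Suc c)))"
      have lb: "length ?b = k" using gne(2) u(1) by blast
      have "hd (g (c # sh (u c) ?b)) = d c" using d_eq lb by blast
      then have "(f c ?b, ?b) \<in> lexn less_than k"
        using mono[of c "Suc c" "sh (u c) ?b" "u (Suc c)"] eq lb u(1)
        by (simp add: f_def d_def sh_len)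
      then show False using lex_mono_not_decreasing[OF f] by blast
    qed
    ultimately show ?thesis by simp
  qed
  then have "strict_mono d" by (simp add: strict_mono_Suc_iff)
  then have "infinite (range d)" by (intro range_inj_infinite strict_mono_imp_inj_on)
  moreover have "range d \<subseteq> {c. positive k {s. c # s \<in> P}}" using pos by auto
  ultimately have "infinite {c. positive k {s. c # s \<in> P}}" by (rule infinite_super[rotated])
  then show ?case by (simp add: INFM_iff_infinite)
qed

lemma positive_lex_mono_image:
  assumes h: "lex_mono k h" and X: "\<And>s. s \<in> X \<Longrightarrow> length s = k"
  shows "positive k (h ` X) \<longleftrightarrow> positive k X"
proof
  assume "positive k X"
  then obtain g where g: "lex_mono k g" "\<And>s. length s = k \<Longrightarrow> g s \<in> X"
    using positive_imp_lex_mono by blast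
  have "lex_mono k (h \<circ> g)" using h g(1) unfolding lex_mono_def comp_def by blast
  then show "positive k (h ` X)" by (rule lex_mono_imp_positive) (simp add: g(2))
next
  assume "positive k (h ` X)"
  then obtain g where g: "lex_mono k g" "\<And>s. length s = k \<Longrightarrow> g s \<in> h ` X"
    using positive_imp_lex_mono by blast
  have "\<exists>x. length s = k \<longrightarrow> x \<in> X \<and> h x = g s" for s using g(2)[of s] by (metis imageE)
  then obtain f where f: "\<And>s. length s = k \<Longrightarrow> f s \<in> X \<and> h (f s) = g s" by metis
  have len: "length (f s) = k" if "length s = k" for s using X[of "f s"] f[OF that] by simp
  have "(f s, f t) \<in> lexn less_than k" if st: "(s, t) \<in> lexn less_than k" for s t
  proof (rule lex_mono_reflects[OF h])
    have l: "length s = k" "length t = k" using st by (auto dest: lexn_length)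
    show "length (f s) = k" "length (f t) = k" using l len by auto
    show "(h (f s), h (f t)) \<in> lexn less_than k" using g(1) st l by (simp only: f lex_mono_def)
  qed
  with len have "lex_mono k f" unfolding lex_mono_def by blast
  then show "positive k X" by (rule lex_mono_imp_positive) (simp add: f)
qed

text \<open>Both directions go through \<open>lex_mono\<close> maps. If the order type is smaller,
  \<open>P\<close> is isomorphic to a proper initial segment, which leaves no room for a copy of
  \<open>\<omega>\<^sup>k\<close>; otherwise comparability of well-orders embeds
  \<open>\<omega>\<^sup>k\<close> into \<open>P\<close>.\<close>

lemma small_ideal_iff:
  "P \<in> small_ideal k \<longleftrightarrow> P \<subseteq> {s. length s = k} \<and> \<not> positive k P"
proof (cases "P \<subseteq> Field (omega_pow k)")
  case P: True
  let ?r = "omega_pow k" and ?p = "Restr (omega_pow k) P"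
  have wr: "Well_order ?r" by (rule Well_order_omega_pow)
  have wp: "Well_order ?p" using wr by (rule Well_order_Restr)
  have FP: "Field ?p = P" using P by (rule Field_Restr_omega_pow)
  have strict: "(x, y) \<in> lexn less_than k" if "(x, y) \<in> ?r" "x \<noteq> y" for x y
    using that by (auto simp: omega_pow_def)
  have weak: "(x, y) \<in> ?r" if "(x, y) \<in> lexn less_than k" for x y
    using that by (auto simp: omega_pow_def dest: lexn_length)
  have "(?p, ?r) \<in> ordLess \<longleftrightarrow> \<not> positive k P"
  proof
    assume "(?p, ?r) \<in> ordLess"
    then obtain a where a: "a \<in> Field ?r" "(?p, Restr ?r (underS ?r a)) \<in> ordIso"
      using ordLess_iff_ordIso_Restr[OF wr wp] by blast
    then obtain f where f: "iso ?p (Restr ?r (underS ?r a)) f" by (auto simp: ordIso_def)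
    have inj: "inj_on f P" using f FP by (auto simp: iso_iff2 bij_betw_def)
    have fu: "f x \<in> underS ?r a" if "x \<in> P" for x
      using f that FP by (auto simp: iso_iff2 bij_betw_def Field_def)
    show "\<not> positive k P"
    proof
      assume "positive k P"
      then obtain g where g: "lex_mono k g" "\<And>s. length s = k \<Longrightarrow> g s \<in> P"
        using positive_imp_lex_mono by blast
      have "lex_mono k (f \<circ> g)"
        unfolding lex_mono_def
      proof (intro conjI allI impI)
        fix s :: "nat list" assume "length s = k"
        then show "length ((f \<circ> g) s) = k" using fu g(2) by (force simp: underS_def omega_pow_def)
      next
        fix s t assume st: "(s, t) \<in> lexn less_than k"
        then have l: "length s = k" "length t = k" by (auto dest: lexn_length)
        have lt: "(g s, g t) \<in> lexn less_than k" using g(1) st by (simp add: lex_mono_def)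
        then have "(g s, g t) \<in> ?p" using weak g(2) l by blast
        then have "(f (g s), f (g t)) \<in> ?r" using iso_forward[OF _ f] by blast
        moreover have "f (g s) \<noteq> f (g t)"
          using inj g(2) l lt lexn_irrefl by (metis inj_onD)
        ultimately show "((f \<circ> g) s, (f \<circ> g) t) \<in> lexn less_than k" using strict by simp
      qed
      \<comment> \<open>All values lie below \<open>a\<close>, in particular the value at
        \<open>a\<close> itself.\<close>
      moreover have "(f (g a), a) \<in> lexn less_than k"
        using fu[OF g(2)[of a]] a(1) strict by (auto simp: underS_def Field_omega_pow)
      ultimately show False using lex_mono_not_decreasing by fastforce
    qed
  next
    assume np: "\<not> positive k P"
    show "(?p, ?r) \<in> ordLess"
    proof (rule ccontr)
      assume "(?p, ?r) \<notin> ordLess"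
      then have "(?r, ?p) \<in> ordLeq" using not_ordLess_iff_ordLeq[OF wr wp] by blast
      then obtain f where f: "embed ?r ?p f" by (auto simp: ordLeq_def)
      have inj: "inj_on f (Field ?r)" using embed_inj_on[OF wr f] .
      have fP: "f s \<in> P" if "length s = k" for s
        using embed_Field[OF f] that FP by (auto simp: Field_omega_pow)
      have "lex_mono k f"
        unfolding lex_mono_def
      proof (intro conjI allI impI)
        fix s :: "nat list" assume "length s = k"
        then show "length (f s) = k" using fP P by (auto simp: Field_omega_pow)
      next
        fix s t assume st: "(s, t) \<in> lexn less_than k"
        then have l: "length s = k" "length t = k" by (auto dest: lexn_length)
        have "(f s, f t) \<in> ?p" using embed_compat[OF f] weak[OF st] by (auto simp: compat_def)
        moreover have "s \<noteq> t" using st lexn_irrefl by auto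
        then have "f s \<noteq> f t" using inj l by (auto simp: inj_on_def Field_omega_pow)
        ultimately show "(f s, f t) \<in> lexn less_than k" using strict by blast
      qed
      then have "positive k P" by (rule lex_mono_imp_positive) (rule fP)
      then show False using np by simp
    qed
  qed
  then show ?thesis using P by (auto simp: small_ideal_def Field_omega_pow)
qed (auto simp: small_ideal_def Field_omega_pow)

subsection \<open>The hierarchy of iterated upper limits of clopen sets\<close>

text \<open>Unfolding \<open>positive\<close> gives \<open>n\<close> nested upper limits, one for
  each entry of the index list. \<open>U\<close> is indexed by all lists, but only those of length
  \<open>n\<close> influence the set.\<close>

definition limsup_class :: "nat \<Rightarrow> 'a::topological_space set set" where
  "limsup_class n = {A. \<exists>U. (\<forall>s. open (U s) \<and> closed (U s)) \<and> A = {z. positive n {s. z \<in> U s}}}"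

lemma clopen_in_limsup_class:
  assumes "open A" "closed A"
  shows "A \<in> limsup_class n"
proof -
  have "positive n {s. z \<in> A} \<longleftrightarrow> z \<in> A" for z by (cases "z \<in> A") simp_all
  then show ?thesis using assms unfolding limsup_class_def by (intro CollectI exI[of _ "\<lambda>_. A"]) simp
qed

text \<open>The head of an index list serves the new outer limit, the tail the old inner
  ones.\<close>

lemma limsup_in_limsup_class_Suc:
  fixes A :: "nat \<Rightarrow> 'a::topological_space set"
  assumes "\<And>k. A k \<in> limsup_class n"
  shows "{z. \<exists>\<^sub>\<infinity>k. z \<in> A k} \<in> limsup_class (Suc n)"
proof -
  have "\<forall>k. \<exists>U. (\<forall>s. open (U s) \<and> closed (U s)) \<and> A k = {z. positive n {s. z \<in> U s}}"
    using assms by (simp add: limsup_class_def)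
  then obtain U where U: "\<And>k s. open (U k s) \<and> closed (U k s)"
    "\<And>k. A k = {z. positive n {s. z \<in> U k s}}" by metis
  show ?thesis
    unfolding limsup_class_def
    by (intro CollectI exI[of _ "\<lambda>s. U (hd s) (tl s)"]) (simp add: U)
qed

lemma limsup_class_mono:
  assumes "n \<le> m"
  shows "(limsup_class n :: 'a::topological_space set set) \<subseteq> limsup_class m"
  using assms
proof (induction m rule: dec_induct)
  case (step m)
  have "A \<in> limsup_class (Suc m)" if "A \<in> limsup_class m" for A :: "'a set"
    using limsup_in_limsup_class_Suc[of "\<lambda>_. A" m] that by simp
  then show ?case using step by blast
qed simp

section \<open>Borel sets from upper limits of clopen sets\<close>

inductive_set limsup_closure :: "'a::topological_space set set" where
  clopen: "open U \<Longrightarrow> closed U \<Longrightarrow> U \<in> limsup_closure"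
| limsup: "(\<And>k::nat. A k \<in> limsup_closure) \<Longrightarrow> {z. \<exists>\<^sub>\<infinity>k. z \<in> A k} \<in> limsup_closure"

text \<open>The union is the upper limit of the alternating sequence
  \<open>A, B, A, B, ...\<close>.\<close>

lemma limsup_closure_Un:
  fixes A B :: "'a::topological_space set"
  assumes "A \<in> limsup_closure" "B \<in> limsup_closure"
  shows "A \<union> B \<in> limsup_closure"
proof -
  have "(\<exists>\<^sub>\<infinity>k::nat. z \<in> (if even k then A else B)) \<longleftrightarrow> z \<in> A \<union> B" for z
  proof
    assume "z \<in> A \<union> B"
    then show "\<exists>\<^sub>\<infinity>k::nat. z \<in> (if even k then A else B)"
    proof
      assume "z \<in> A"
      then have "2 * m \<ge> m \<and> z \<in> (if even (2 * m) then A else B)" for m :: nat by simp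
      then show ?thesis unfolding INFM_nat_le by blast
    next
      assume "z \<in> B"
      then have "2 * m + 1 \<ge> m \<and> z \<in> (if even (2 * m + 1) then A else B)" for m :: nat by simp
      then show ?thesis unfolding INFM_nat_le by blast
    qed
  qed (auto dest!: INFM_EX split: if_splits)
  moreover have "(if even k then A else B) \<in> limsup_closure" for k :: nat using assms by simp
  ultimately show ?thesis using limsup_closure.limsup[of "\<lambda>k. if even k then A else B"]
    by (simp only: Collect_mem_eq)
qed

text \<open>The finite partial unions increase, so their upper limit is their union.\<close>

lemma limsup_closure_UN:
  fixes A :: "nat \<Rightarrow> 'a::topological_space set"
  assumes "\<And>k. A k \<in> limsup_closure"
  shows "(\<Union>k. A k) \<in> limsup_closure"
proof -
  have "(\<Union>i\<le>k. A i) \<in> limsup_closure" for k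
    by (induction k) (simp_all add: assms atMost_Suc limsup_closure_Un)
  moreover have "(\<exists>\<^sub>\<infinity>k. z \<in> (\<Union>i\<le>k. A i)) \<longleftrightarrow> z \<in> (\<Union>k. A k)" for z
  proof
    assume "z \<in> (\<Union>k. A k)"
    then obtain i where "z \<in> A i" by blast
    then have "max m i \<ge> m \<and> z \<in> (\<Union>i\<le>max m i. A i)" for m by auto
    then show "\<exists>\<^sub>\<infinity>k. z \<in> (\<Union>i\<le>k. A i)" unfolding INFM_nat_le by blast
  qed (auto dest!: INFM_EX)
  ultimately show ?thesis using limsup_closure.limsup[of "\<lambda>k. \<Union>i\<le>k. A i"]
    by (simp only: Collect_mem_eq)
qed

text \<open>Intersecting with a fixed set commutes with upper limits. Two inductions are needed:
  first on one factor with the other clopen, then on the remaining factor.\<close>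

lemma limsup_closure_Int:
  fixes A B :: "'a::topological_space set"
  assumes "A \<in> limsup_closure" "B \<in> limsup_closure"
  shows "A \<inter> B \<in> limsup_closure"
proof -
  have *: "U \<inter> B \<in> limsup_closure" if "open U" "closed U" "B \<in> limsup_closure" for U B :: "'a set"
    using that(3)
  proof induction
    case (limsup B)
    have "U \<inter> {z. \<exists>\<^sub>\<infinity>k. z \<in> B k} = {z. \<exists>\<^sub>\<infinity>k. z \<in> U \<inter> B k}" by auto
    then show ?case using limsup_closure.limsup[OF limsup.IH] by simp
  qed (use that in \<open>auto intro: limsup_closure.clopen\<close>)
  show ?thesis
    using assms(1)
  proof induction
    case (limsup A)
    have "{z. \<exists>\<^sub>\<infinity>k. z \<in> A k} \<inter> B = {z. \<exists>\<^sub>\<infinity>k. z \<in> A k \<inter> B}" by auto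
    then show ?case using limsup_closure.limsup[OF limsup.IH] by simp
  qed (use * assms in auto)
qed

text \<open>The finite partial intersections decrease, so their upper limit is their
  intersection.\<close>

lemma limsup_closure_INT:
  fixes A :: "nat \<Rightarrow> 'a::topological_space set"
  assumes "\<And>k. A k \<in> limsup_closure"
  shows "(\<Inter>k. A k) \<in> limsup_closure"
proof -
  have "(\<Inter>i\<le>k. A i) \<in> limsup_closure" for k
    by (induction k) (simp_all add: assms atMost_Suc limsup_closure_Int)
  moreover have "(\<exists>\<^sub>\<infinity>k. z \<in> (\<Inter>i\<le>k. A i)) \<longleftrightarrow> z \<in> (\<Inter>k. A k)" for z
    unfolding INFM_nat_le by auto
  ultimately show ?thesis using limsup_closure.limsup[of "\<lambda>k. \<Inter>i\<le>k. A i"]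
    by (simp only: Collect_mem_eq)
qed

text \<open>The complement of an upper limit is a lower limit of complements, that is, a countable
  union of countable intersections. The value \<open>UNIV\<close> below \<open>m\<close> lets the
  intersection run over all indices.\<close>

lemma limsup_closure_Compl:
  fixes A :: "'a::topological_space set"
  assumes "A \<in> limsup_closure"
  shows "- A \<in> limsup_closure"
  using assms
proof induction
  case (clopen U)
  then show ?case by (intro limsup_closure.clopen) (auto simp: open_Compl closed_Compl)
next
  case (limsup A)
  have "- {z. \<exists>\<^sub>\<infinity>k. z \<in> A k} = (\<Union>m. \<Inter>k. (if k \<ge> m then - A k else UNIV))"
    by (auto simp: INFM_nat_le split: if_splits)
  moreover have "(if k \<ge> m then - A k else UNIV) \<in> limsup_closure" for m k :: nat
    using limsup.IH by (auto intro: limsup_closure.clopen)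
  ultimately show ?case by (simp only: limsup_closure_UN limsup_closure_INT)
qed

section \<open>Cylinders in the Cantor space\<close>

text \<open>The total decoding \<open>from_nat\<close> enumerates the finite bit strings, and so the
  basic clopen sets, by all natural numbers. The later codes of open sets refer to this
  enumeration.\<close>

definition cylinder :: "nat \<Rightarrow> (nat \<Rightarrow> bool) set" where
  "cylinder j = {z. \<forall>i<length (from_nat j :: bool list). z i = (from_nat j :: bool list) ! i}"

lemma clopen_eval: "open {z :: nat \<Rightarrow> bool. z i = b}" "closed {z :: nat \<Rightarrow> bool. z i = b}"
proof -
  have c: "continuous_on UNIV (\<lambda>z :: nat \<Rightarrow> bool. z i)" by (rule continuous_on_product_coordinates)
  have "{z. z i = b} = (\<lambda>z :: nat \<Rightarrow> bool. z i) -` {b}" by auto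
  then show "open {z :: nat \<Rightarrow> bool. z i = b}" "closed {z :: nat \<Rightarrow> bool. z i = b}"
    using open_vimage[OF open_discrete c] closed_vimage[OF closed_singleton c] by simp_all
qed

lemma clopen_cylinder: "open (cylinder j)" "closed (cylinder j)"
proof -
  have eq: "cylinder j = (\<Inter>i\<in>{..<length (from_nat j :: bool list)}. {z. z i = (from_nat j :: bool list) ! i})"
    by (auto simp: cylinder_def)
  show "open (cylinder j)" unfolding eq by (rule open_INT) (simp_all add: clopen_eval)
  show "closed (cylinder j)" unfolding eq by (rule closed_INT) (simp add: clopen_eval)
qed

lemma open_contains_cylinder:
  assumes "open U" "z \<in> U"
  shows "\<exists>j. z \<in> cylinder j \<and> cylinder j \<subseteq> U"
proof -
  have "openin (product_topology (\<lambda>_::nat. euclidean :: bool topology) UNIV) U"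
    using assms(1) by (simp add: euclidean_product_topology)
  from product_topology_open_contains_basis[OF this assms(2)]
  obtain X where X: "z \<in> (\<Pi>\<^sub>E i\<in>UNIV. X i)" "finite {i. X i \<noteq> UNIV}" "(\<Pi>\<^sub>E i\<in>UNIV. X i) \<subseteq> U"
    by auto
  \<comment> \<open>Only finitely many coordinates are restricted, so an initial segment of
    \<open>z\<close> already decides membership.\<close>
  obtain k where k: "{i. X i \<noteq> UNIV} \<subseteq> {..<k}" using finite_nat_bounded[OF X(2)] by blast
  have "y \<in> (\<Pi>\<^sub>E i\<in>UNIV. X i)" if y: "\<And>i. i < k \<Longrightarrow> y i = z i" for y
  proof -
    have "y i \<in> X i" for i
    proof (cases "i < k")
      case True then show ?thesis using y X(1) by (auto simp: PiE_iff)
    next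
      case False then have "X i = UNIV" using k by blast
      then show ?thesis by simp
    qed
    then show ?thesis by auto
  qed
  then have "cylinder (to_nat (map z [0..<k])) \<subseteq> (\<Pi>\<^sub>E i\<in>UNIV. X i)" by (simp add: cylinder_def subset_iff)
  then have "cylinder (to_nat (map z [0..<k])) \<subseteq> U" using X(3) by blast
  moreover have "z \<in> cylinder (to_nat (map z [0..<k]))" by (simp add: cylinder_def)
  ultimately show ?thesis by blast
qed

lemma open_eq_UN_cylinder:
  assumes "open U"
  shows "U = (\<Union>j. if cylinder j \<subseteq> U then cylinder j else {})"
proof
  show "U \<subseteq> (\<Union>j. if cylinder j \<subseteq> U then cylinder j else {})"
  proof
    fix z assume "z \<in> U"
    then obtain j where "z \<in> cylinder j" "cylinder j \<subseteq> U" using open_contains_cylinder[OF assms] by blast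
    then show "z \<in> (\<Union>j. if cylinder j \<subseteq> U then cylinder j else {})" by (intro UN_I[of j]) auto
  qed
qed (auto split: if_splits)

lemma borel_subset_limsup_closure:
  fixes A :: "(nat \<Rightarrow> bool) set"
  assumes "A \<in> sets borel"
  shows "A \<in> limsup_closure"
proof -
  have "A \<in> sigma_sets UNIV {S. open S}" using assms by (simp add: borel_def)
  then show ?thesis
  proof induction
    case (Basic U)
    have "(if cylinder j \<subseteq> U then cylinder j else {}) \<in> limsup_closure" for j
      by (rule limsup_closure.clopen) (simp_all add: clopen_cylinder)
    then have "(\<Union>j. if cylinder j \<subseteq> U then cylinder j else {}) \<in> limsup_closure"
      by (rule limsup_closure_UN)
    then show ?case using open_eq_UN_cylinder[of U] Basic by simp
  next
    case Empty
    show ?case by (rule limsup_closure.clopen) simp_all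
  next
    case (Compl A)
    then show ?case unfolding Compl_eq_Diff_UNIV[symmetric] by (simp only: limsup_closure_Compl)
  next
    case (Union A)
    show ?case by (rule limsup_closure_UN) (rule Union)
  qed
qed

section \<open>A universal set and its antidiagonal\<close>

lemma measurable_positive:
  assumes "\<And>s. Measurable.pred M (P s)"
  shows "Measurable.pred M (\<lambda>z. positive n {s. P s z})"
  using assms
proof (induction n arbitrary: P)
  case (Suc n)
  have [measurable]: "Measurable.pred M (\<lambda>z. positive n {s. P (c # s) z})" for c
    by (rule Suc.IH) (rule Suc.prems)
  show ?case by (simp add: INFM_nat)
qed simp

lemma diagonal_not_in_limsup_class:
  "\<exists>D :: (nat \<Rightarrow> bool) set. D \<in> sets borel \<and> D \<notin> limsup_class n"
proof -
  \<comment> \<open>A point \<open>z\<close> codes a sequence of open sets indexed by lists: the bit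
    at \<open>(s, j)\<close> tells whether cylinder \<open>j\<close> is put into the set number
    \<open>s\<close>. \<open>R s z\<close> says that \<open>z\<close> belongs to the set number
    \<open>s\<close> coded by \<open>z\<close> itself.\<close>
  define R where "R s z \<longleftrightarrow> (\<exists>j. z (prod_encode (to_nat s, j)) \<and> z \<in> cylinder j)"
    for s :: "nat list" and z
  define D where "D = {z. \<not> positive n {s. R s z}}"
  have "open {z. R s z}" for s
  proof -
    have "{z. R s z} = (\<Union>j. {z. z (prod_encode (to_nat s, j)) = True} \<inter> cylinder j)"
      by (auto simp: R_def)
    also have "open \<dots>" by (intro open_UN ballI open_Int clopen_eval clopen_cylinder)
    finally show ?thesis .
  qed
  then have "Measurable.pred borel (\<lambda>z. positive n {s. R s z})"
    by (intro measurable_positive) (simp add: pred_def borel_open)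
  then have "- {z. positive n {s. R s z}} \<in> sets borel" by (intro borel_comp) (simp add: pred_def)
  then have "D \<in> sets borel" unfolding D_def by (simp only: Collect_neg_eq)
  moreover have "D \<notin> limsup_class n"
  proof
    assume "D \<in> limsup_class n"
    then have "\<exists>U. (\<forall>s. open (U s) \<and> closed (U s)) \<and> D = {z. positive n {s. z \<in> U s}}"
      unfolding limsup_class_def by (rule CollectD)
    then obtain U where "(\<forall>s. open (U s) \<and> closed (U s)) \<and> D = {z. positive n {s. z \<in> U s}}" ..
    then have U: "\<And>s. open (U s)" "D = {z. positive n {s. z \<in> U s}}" by (simp_all only:)
    \<comment> \<open>The code of the sequence \<open>U\<close>. At this point \<open>R s z\<close>
      agrees with \<open>z \<in> U s\<close>, so \<open>D\<close> contradicts its own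
      representation.\<close>
    define z where "z i \<longleftrightarrow> (\<exists>s j. i = prod_encode (to_nat (s :: nat list), j) \<and> cylinder j \<subseteq> U s)" for i
    have z: "z (prod_encode (to_nat s, j)) \<longleftrightarrow> cylinder j \<subseteq> U s" for s j
      unfolding z_def by simp
    have "R s z \<longleftrightarrow> z \<in> U s" for s
      using open_contains_cylinder[OF U(1), of z s] unfolding R_def z by blast
    then have "z \<notin> D \<longleftrightarrow> positive n {s. z \<in> U s}" by (simp add: D_def)
    moreover have "z \<in> D \<longleftrightarrow> positive n {s. z \<in> U s}" unfolding U(2) by simp
    ultimately show False by simp
  qed
  ultimately show ?thesis by blast
qed

lemma limsup_class_strict:
  assumes "n < m"
  shows "\<not> (limsup_class m :: (nat \<Rightarrow> bool) set set) \<subseteq> limsup_class n"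
proof
  assume sub: "(limsup_class m :: (nat \<Rightarrow> bool) set set) \<subseteq> limsup_class n"
  have "A \<in> limsup_class n" if "A \<in> limsup_closure" for A :: "(nat \<Rightarrow> bool) set"
    using that
  proof induction
    case (clopen U)
    then show ?case by (rule clopen_in_limsup_class)
  next
    case (limsup A)
    \<comment> \<open>One more upper limit leads to level \<open>Suc n\<close>, which is contained
      in level \<open>m\<close> and so falls back into level \<open>n\<close>.\<close>
    have "{z. \<exists>\<^sub>\<infinity>k. z \<in> A k} \<in> limsup_class (Suc n)"
      using limsup.IH by (rule limsup_in_limsup_class_Suc)
    then show ?case using limsup_class_mono[of "Suc n" m] assms sub by (meson Suc_leI subsetD)
  qed
  then show False using diagonal_not_in_limsup_class[of n] borel_subset_limsup_closure by blast
qed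

subsection \<open>Continuity and analyticity on power sets\<close>

lemma powerset_topology_clopen_mem:
  assumes "a \<in> A"
  shows "openin (powerset_topology A) {X \<in> Pow A. a \<in> X}" "closedin (powerset_topology A) {X \<in> Pow A. a \<in> X}"
proof -
  let ?D = "discrete_topology (UNIV :: bool set)"
  have "continuous_map (powerset_topology A) ?D ((\<lambda>f. f a) \<circ> (\<lambda>X. \<lambda>a\<in>A. a \<in> X))"
    unfolding powerset_topology_def
    by (intro continuous_map_pullback continuous_map_product_projection assms)
  then have c: "continuous_map (powerset_topology A) ?D (\<lambda>X. a \<in> X)" using assms by (simp add: o_def)
  show "openin (powerset_topology A) {X \<in> Pow A. a \<in> X}"
    using openin_continuous_map_preimage[OF c, of "{True}"] by simp
  show "closedin (powerset_topology A) {X \<in> Pow A. a \<in> X}"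
    using closedin_continuous_map_preimage[OF c, of "{True}"] by simp
qed

text \<open>Continuity into a product of discrete two-point spaces can be tested on each coordinate,
  where it means that membership of \<open>a\<close> is a clopen condition.\<close>

lemma continuous_map_into_powerset_topology:
  fixes G :: "'a::topological_space \<Rightarrow> 'b set"
  assumes "\<And>z. G z \<subseteq> A" "\<And>a. a \<in> A \<Longrightarrow> open {z. a \<in> G z}" "\<And>a. a \<in> A \<Longrightarrow> closed {z. a \<in> G z}"
  shows "continuous_map euclidean (powerset_topology A) G"
  unfolding powerset_topology_def
proof (rule continuous_map_pullback')
  have "continuous_map euclidean (discrete_topology (UNIV :: bool set)) (\<lambda>z. a \<in> G z)" if a: "a \<in> A" for a
    unfolding continuous_map_def
  proof (intro conjI allI impI)
    fix V :: "bool set"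
    have "open {z. a \<in> G z}" "open {z. a \<notin> G z}"
      using assms(2,3)[OF a] open_Compl[of "{z. a \<in> G z}"] by (simp_all only: Collect_neg_eq)
    then have "open ({z. a \<in> G z \<and> True \<in> V} \<union> {z. a \<notin> G z \<and> False \<in> V})"
      by (intro open_Un open_Collect_conj) simp_all
    moreover have "{z. (a \<in> G z) \<in> V} = {z. a \<in> G z \<and> True \<in> V} \<union> {z. a \<notin> G z \<and> False \<in> V}"
    proof (rule set_eqI)
      fix z show "z \<in> {z. (a \<in> G z) \<in> V} \<longleftrightarrow> z \<in> {z. a \<in> G z \<and> True \<in> V} \<union> {z. a \<notin> G z \<and> False \<in> V}"
        by (cases "a \<in> G z") auto
    qed
    ultimately show "openin euclidean {z \<in> topspace euclidean. (a \<in> G z) \<in> V}" by simp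
  qed simp
  then show "continuous_map euclidean (product_topology (\<lambda>_. discrete_topology (UNIV :: bool set)) A)
      ((\<lambda>X. \<lambda>a\<in>A. a \<in> X) \<circ> G)"
    by (auto simp: continuous_map_componentwise)
  show "topspace euclidean \<subseteq> G -` Pow A" using assms(1) by auto
qed

text \<open>The witness function \<open>w\<close> from \<open>not_positive_iff_witness\<close>,
  moved to natural numbers by \<open>to_nat\<close>, is a point of Baire space. For each
  \<open>y\<close> the requirement \<open>K y\<close> looks at one bit of the set and at finitely
  many values of \<open>w\<close>, so it is closed; the ideal is the projection of the intersection
  of all \<open>K y\<close>.\<close>

lemma Sigma11_not_positive:
  assumes b: "\<And>y::nat. length (b y) = n"
  shows "Sigma11_in (powerset_topology UNIV) {Y. \<not> positive n (b ` Y)}"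
proof -
  let ?B = "product_topology (\<lambda>_. discrete_topology (UNIV :: nat set)) (UNIV :: nat set)"
  let ?T = "prod_topology (powerset_topology (UNIV :: nat set)) ?B"
  define K where "K y = {p. y \<notin> fst p} \<union>
    (\<Union>i\<in>{..<n}. {p. b y ! i < snd p (to_nat (take i (b y)))})"
    for y :: nat and p :: "nat set \<times> (nat \<Rightarrow> nat)"
  have top: "topspace ?T = UNIV" by simp
  have cf: "continuous_map ?T (powerset_topology UNIV) fst" by (rule continuous_map_fst)
  have cs: "continuous_map ?T ?B snd" by (rule continuous_map_snd)
  have "closedin ?T (K y)" for y
    unfolding K_def
  proof (intro closedin_Un closedin_Union ballI)
    have "closedin (powerset_topology UNIV) (topspace (powerset_topology UNIV) - {X \<in> Pow UNIV. y \<in> X})"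
      by (intro closedin_diff closedin_topspace powerset_topology_clopen_mem) simp
    from closedin_continuous_map_preimage[OF cf this]
    show "closedin ?T {p. y \<notin> fst p}" by (simp add: top)
  next
    show "finite ((\<lambda>i. {p :: nat set \<times> (nat \<Rightarrow> nat). b y ! i < snd p (to_nat (take i (b y)))}) ` {..<n})" by simp
  next
    fix S assume "S \<in> (\<lambda>i. {p :: nat set \<times> (nat \<Rightarrow> nat). b y ! i < snd p (to_nat (take i (b y)))}) ` {..<n}"
    then obtain i where S: "S = {p. b y ! i < snd p (to_nat (take i (b y)))}" by blast
    have "continuous_map ?T (discrete_topology UNIV) ((\<lambda>w. w (to_nat (take i (b y)))) \<circ> snd)"
      by (intro continuous_map_compose[OF cs] continuous_map_product_projection) simp
    from closedin_continuous_map_preimage[OF this, of "{x. b y ! i < x}"]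
    show "closedin ?T S" by (simp add: S top)
  qed
  then have "closedin ?T (\<Inter>y. K y)" by (intro closedin_INT) auto
  moreover have "{Y. \<not> positive n (b ` Y)} = fst ` (\<Inter>y. K y)"
  proof (rule set_eqI)
    fix Y
    have "\<not> positive n (b ` Y) \<longleftrightarrow> (\<exists>w. \<forall>y\<in>Y. \<exists>i<n. b y ! i < w (take i (b y)))"
      by (simp add: not_positive_iff_witness b)
    also have "\<dots> \<longleftrightarrow> (\<exists>w. \<forall>y\<in>Y. \<exists>i<n. b y ! i < w (to_nat (take i (b y))))"
    proof
      assume "\<exists>w. \<forall>y\<in>Y. \<exists>i<n. b y ! i < w (take i (b y))"
      then obtain w where w: "\<forall>y\<in>Y. \<exists>i<n. b y ! i < w (take i (b y))" ..
      then show "\<exists>w. \<forall>y\<in>Y. \<exists>i<n. b y ! i < w (to_nat (take i (b y)))"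
        by (intro exI[of _ "w \<circ> from_nat"]) simp
    next
      assume "\<exists>w. \<forall>y\<in>Y. \<exists>i<n. b y ! i < w (to_nat (take i (b y)))"
      then obtain w where w: "\<forall>y\<in>Y. \<exists>i<n. b y ! i < w (to_nat (take i (b y)))" ..
      then show "\<exists>w. \<forall>y\<in>Y. \<exists>i<n. b y ! i < w (take i (b y))"
        by (intro exI[of _ "w \<circ> to_nat"]) simp
    qed
    also have "\<dots> \<longleftrightarrow> (\<exists>w. (Y, w) \<in> (\<Inter>y. K y))"
      by (intro ex_cong1) (auto simp: K_def)
    also have "\<dots> \<longleftrightarrow> Y \<in> fst ` (\<Inter>y. K y)" by (simp only: image_iff Bex_def split_paired_Ex fst_conv) metis
    finally show "Y \<in> {Y. \<not> positive n (b ` Y)} \<longleftrightarrow> Y \<in> fst ` (\<Inter>y. K y)" by simp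
  qed
  ultimately show ?thesis unfolding Sigma11_in_def by blast
qed

subsection \<open>An uncountable almost disjoint family\<close>

lemma uncountable_nat_bool: "uncountable (UNIV :: (nat \<Rightarrow> bool) set)"
proof
  assume "countable (UNIV :: (nat \<Rightarrow> bool) set)"
  then obtain e :: "nat \<Rightarrow> nat \<Rightarrow> bool" where e: "range e = UNIV"
    using uncountable_def[of "UNIV :: (nat \<Rightarrow> bool) set"] by auto
  then obtain i where "(\<lambda>j. \<not> e j j) = e i" by (metis UNIV_I imageE)
  from fun_cong[OF this, of i] show False by simp
qed

text \<open>The branches of the binary tree: \<open>B x\<close> consists of the codes of the initial
  segments of \<open>x\<close>, and two branches share only the segments before they split.\<close>

lemma almost_disjoint_family:
  "\<exists>\<D> :: nat set set. uncountable \<D> \<and> (\<forall>D\<in>\<D>. infinite D) \<and> pairwise (\<lambda>A B. finite (A \<inter> B)) \<D>"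
proof -
  define B where "B x = range (\<lambda>k. to_nat (map x [0..<k]))" for x :: "nat \<Rightarrow> bool"
  have inf: "infinite (B x)" for x
    unfolding B_def by (rule range_inj_infinite) (rule injI, drule arg_cong[of _ _ "\<lambda>j. length (from_nat j :: bool list)"], simp)
  have fin: "finite (B x \<inter> B y)" if "x \<noteq> y" for x y
  proof -
    obtain i where i: "x i \<noteq> y i" using \<open>x \<noteq> y\<close> by blast
    have "B x \<inter> B y \<subseteq> (\<lambda>k. to_nat (map x [0..<k])) ` {..i}"
    proof
      fix v assume "v \<in> B x \<inter> B y"
      then obtain k l where v: "v = to_nat (map x [0..<k])" "v = to_nat (map y [0..<l])"
        unfolding B_def by blast
      then have eq: "map x [0..<k] = map y [0..<l]" by simp
      then have "k = l" by (metis length_map length_upt minus_nat.diff_0)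
      have "k \<le> i"
      proof (rule ccontr)
        assume "\<not> k \<le> i"
        then show False using arg_cong[OF eq, of "\<lambda>s. s ! i"] i \<open>k = l\<close> by simp
      qed
      then show "v \<in> (\<lambda>k. to_nat (map x [0..<k])) ` {..i}" using v(1) by auto
    qed
    then show ?thesis by (rule finite_subset) simp
  qed
  have "inj B"
  proof (rule injI, rule ccontr)
    fix x y assume "B x = B y" "x \<noteq> y"
    then show False using inf[of x] fin[of x y] by simp
  qed
  then have "uncountable (range B)" using uncountable_nat_bool by (simp add: countable_image_inj_eq)
  moreover have "\<forall>D\<in>range B. infinite D" using inf by auto
  moreover have "pairwise (\<lambda>A B. finite (A \<inter> B)) (range B)"
  proof (rule pairwiseI)
    fix A C assume "A \<in> range B" "C \<in> range B" "A \<noteq> C"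
    then obtain x y where "A = B x" "C = B y" "x \<noteq> y" by blast
    then show "finite (A \<inter> C)" using fin by simp
  qed
  ultimately show ?thesis by blast
qed

lemma bij_nat_lists_length:
  assumes "k \<ge> 1"
  shows "\<exists>b :: nat \<Rightarrow> nat list. bij_betw b UNIV {s. length s = k}"
proof -
  have "positive k {s. length s = k}" by (rule positive_mono[OF positive_UNIV]) simp
  then have "infinite {s :: nat list. length s = k}" using finite_imp_not_positive[OF _ assms] by blast
  then show ?thesis using bij_betw_from_nat_into[of "{s :: nat list. length s = k}"] by blast
qed

subsection \<open>From a lifting to a collapse of the hierarchy\<close>

text \<open>A clopen family \<open>U\<close> over lists of length \<open>m\<close> is copied into
  \<open>P\<close> as a set \<open>G z\<close> depending continuously on \<open>z\<close>. Applying
  \<open>F\<close> and reading off membership coordinatewise gives a clopen family over lists of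
  length \<open>n\<close> that defines the same set.\<close>

lemma continuous_reduction_imp_limsup_class_subset:
  fixes F :: "nat set \<Rightarrow> nat set"
  assumes bm: "bij_betw bm UNIV {s. length s = m}" and bn: "bij_betw bn UNIV {s. length s = n}"
    and P: "positive m (bm ` P)"
    and F: "continuous_map (powerset_topology P) (powerset_topology UNIV) F"
    and red: "\<And>X. X \<subseteq> P \<Longrightarrow> positive n (bn ` F X) \<longleftrightarrow> positive m (bm ` X)"
  shows "(limsup_class m :: 'a::topological_space set set) \<subseteq> limsup_class n"
proof
  fix A :: "'a set" assume "A \<in> limsup_class m"
  then have "\<exists>U. (\<forall>s. open (U s) \<and> closed (U s)) \<and> A = {z. positive m {s. z \<in> U s}}"
    unfolding limsup_class_def by (rule CollectD)
  then obtain U where "(\<forall>s. open (U s) \<and> closed (U s)) \<and> A = {z. positive m {s. z \<in> U s}}" ..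
  then have U: "\<And>s. open (U s)" "\<And>s. closed (U s)" "A = {z. positive m {s. z \<in> U s}}" by simp_all
  obtain g where g: "lex_mono m g" "\<And>s. length s = m \<Longrightarrow> g s \<in> bm ` P"
    using positive_imp_lex_mono[OF P] by blast
  have inj_bm: "inj bm" using bm by (rule bij_betw_imp_inj_on)
  define G where "G z = bm -` (g ` {s. length s = m \<and> z \<in> U s})" for z
  have G_sub: "G z \<subseteq> P" for z
  proof
    fix p assume "p \<in> G z"
    then obtain s where "length s = m" "bm p = g s" by (auto simp: G_def)
    then have "bm p \<in> bm ` P" using g(2) by simp
    then show "p \<in> P" using inj_bm by (simp add: inj_image_mem_iff)
  qed
  have G_pos: "positive m (bm ` G z) \<longleftrightarrow> positive m {s. z \<in> U s}" for z
  proof -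
    have "g s \<in> range bm" if "length s = m" for s using subsetD[OF image_mono[OF subset_UNIV] g(2)[OF that]] .
    then have "g ` {s. length s = m \<and> z \<in> U s} \<subseteq> range bm" by (simp add: image_subset_iff)
    then have "bm ` G z = g ` {s. length s = m \<and> z \<in> U s}"
      unfolding G_def image_vimage_eq by (rule Int_absorb2)
    then have "positive m (bm ` G z) \<longleftrightarrow> positive m {s. length s = m \<and> z \<in> U s}"
      using positive_lex_mono_image[OF g(1), of "{s. length s = m \<and> z \<in> U s}"] by simp
    also have "\<dots> \<longleftrightarrow> positive m {s. z \<in> U s}"
      by (intro iffI; erule positive_mono) simp_all
    finally show ?thesis .
  qed
  \<comment> \<open>As \<open>g\<close> is injective, at most one list \<open>s\<close> is
    responsible for \<open>p\<close>, and then the condition is just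
    \<open>z \<in> U s\<close>.\<close>
  have G_clopen: "open {z. p \<in> G z} \<and> closed {z. p \<in> G z}" for p
  proof (cases "\<exists>s. length s = m \<and> bm p = g s")
    case True
    then obtain s where s: "length s = m" "bm p = g s" by blast
    have "p \<in> G z \<longleftrightarrow> z \<in> U s" for z
    proof
      assume "p \<in> G z"
      then obtain t where t: "length t = m" "z \<in> U t" "g t = g s" using s(2) by (auto simp: G_def)
      then have "t = s" using inj_onD[OF lex_mono_inj[OF g(1)] t(3)] s(1) by simp
      then show "z \<in> U s" using t by simp
    qed (simp add: G_def s)
    then show ?thesis using U(1,2)[of s] by simp
  next
    case False
    then have "{z. p \<in> G z} = {}" by (auto simp: G_def)
    then show ?thesis by (simp only: open_empty closed_empty)
  qed
  have G_cont: "continuous_map euclidean (powerset_topology P) G"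
    using G_sub G_clopen by (intro continuous_map_into_powerset_topology) simp_all
  have FG: "continuous_map euclidean (powerset_topology UNIV) (F \<circ> G)"
    by (rule continuous_map_compose[OF G_cont F])
  \<comment> \<open>For lists of length different from \<open>n\<close> the value of
    \<open>inv bn\<close> is arbitrary; \<open>positive n\<close> does not see them.\<close>
  define V where "V s = {z. inv bn s \<in> F (G z)}" for s
  have "open (V s)" "closed (V s)" for s
    using openin_continuous_map_preimage[OF FG powerset_topology_clopen_mem(1)[of "inv bn s"]]
      closedin_continuous_map_preimage[OF FG powerset_topology_clopen_mem(2)[of "inv bn s"]]
    by (simp_all add: V_def)
  moreover have "positive m {s. z \<in> U s} \<longleftrightarrow> positive n {s. z \<in> V s}" for z
  proof -
    have inv: "inv bn s \<in> Y \<longleftrightarrow> s \<in> bn ` Y" if "length s = n" for s Y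
    proof -
      have "s \<in> range bn" using bij_betw_imp_surj_on[OF bn] that by simp
      then obtain y where "s = bn y" ..
      then show ?thesis using bij_betw_imp_inj_on[OF bn] by (simp add: inj_image_mem_iff)
    qed
    have "positive m {s. z \<in> U s} \<longleftrightarrow> positive n (bn ` F (G z))"
      using red[OF G_sub] G_pos by simp
    also have "\<dots> \<longleftrightarrow> positive n {s. z \<in> V s}"
      by (intro iffI; erule positive_mono) (simp_all add: V_def inv)
    finally show ?thesis .
  qed
  ultimately show "A \<in> limsup_class n"
    unfolding limsup_class_def U(3) by (intro CollectI exI[of _ V] conjI allI Collect_cong)
qed

text \<open>AT speaks about subsets of \<omega>, so \<open>h\<close> and the ideal are moved there
  by enumerations \<open>bm\<close> and \<open>bn\<close> of the two sets of lists.\<close>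

lemma no_lifting_of_embedding:
  fixes h :: "nat list set \<Rightarrow> nat list set"
  assumes AT: axiom_AT and mn: "n < m" and n: "n \<ge> 1"
    and h_sub: "\<And>X. X \<subseteq> {s. length s = m} \<Longrightarrow> h X \<subseteq> {s. length s = n}"
    and h_pos: "\<And>X. X \<subseteq> {s. length s = m} \<Longrightarrow> positive n (h X) \<longleftrightarrow> positive m X"
    and h_fin: "\<And>X Y. X \<subseteq> {s. length s = m} \<Longrightarrow> Y \<subseteq> {s. length s = m} \<Longrightarrow>
        finite (sym_diff X Y) \<Longrightarrow> \<not> positive n (sym_diff (h X) (h Y))"
    and h_Int: "\<And>X Y. X \<subseteq> {s. length s = m} \<Longrightarrow> Y \<subseteq> {s. length s = m} \<Longrightarrow>
        \<not> positive n (sym_diff (h (X \<inter> Y)) (h X \<inter> h Y))"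
  shows False
proof -
  have m: "m \<ge> 1" using mn by simp
  obtain bm :: "nat \<Rightarrow> nat list" where bm: "bij_betw bm UNIV {s. length s = m}"
    using bij_nat_lists_length[OF m] by blast
  obtain bn :: "nat \<Rightarrow> nat list" where bn: "bij_betw bn UNIV {s. length s = n}"
    using bij_nat_lists_length[OF n] by blast
  have inj: "inj bm" "inj bn" using bm bn by (auto dest: bij_betw_imp_inj_on)
  have ran: "range bm = {s. length s = m}" "range bn = {s. length s = n}"
    using bm bn by (auto dest: bij_betw_imp_surj_on)
  have bm_sub: "bm ` X \<subseteq> {s. length s = m}" for X using ran by auto
  have sym: "f ` sym_diff X Y = sym_diff (f ` X) (f ` Y)" if "inj f" for f :: "nat \<Rightarrow> nat list" and X Y
    by (simp add: image_Un image_set_diff[OF that])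
  define I where "I = {Y. \<not> positive n (bn ` Y)}"
  define H where "H Y = bn -` h (bm ` Y)" for Y
  have bnH: "bn ` H Y = h (bm ` Y)" for Y
    unfolding H_def image_vimage_eq ran using h_sub[OF bm_sub] by (rule Int_absorb2)

  have "set_ideal UNIV I"
    unfolding set_ideal_def
  proof (intro conjI ballI allI impI)
    fix X Y assume "X \<in> I" "Y \<subseteq> X"
    then show "Y \<in> I" using positive_mono[of n "bn ` Y" "bn ` X"] by (auto simp: I_def)
  next
    fix X Y assume "X \<in> I" "Y \<in> I"
    then show "X \<union> Y \<in> I" by (simp add: I_def image_Un positive_Un)
  next
    fix X :: "nat set" assume "X \<subseteq> UNIV \<and> finite X"
    then show "X \<in> I" using finite_imp_not_positive[OF _ n] by (simp add: I_def)
  next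
    have "positive n {s. length s = n}" by (rule positive_mono[OF positive_UNIV]) simp
    then show "UNIV \<notin> I" by (simp add: I_def ran)
  qed simp
  moreover have "length (bn y) = n" for y using ran by auto
  then have "Sigma11_in (powerset_topology UNIV) I" unfolding I_def by (rule Sigma11_not_positive)
  moreover have "preserves_inter_mod UNIV UNIV I H"
    unfolding preserves_inter_mod_def
  proof (intro conjI allI impI)
    fix X Y :: "nat set" assume "X \<subseteq> UNIV \<and> Y \<subseteq> UNIV \<and> finite (sym_diff X Y)"
    then have "finite (sym_diff (bm ` X) (bm ` Y))" unfolding sym[OF inj(1), symmetric] by simp
    then show "sym_diff (H X) (H Y) \<in> I"
      unfolding I_def mem_Collect_eq sym[OF inj(2)] bnH by (rule h_fin[OF bm_sub bm_sub])
  next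
    fix X Y :: "nat set"
    show "sym_diff (H (X \<inter> Y)) (H X \<inter> H Y) \<in> I"
      unfolding I_def mem_Collect_eq sym[OF inj(2)] image_Int[OF inj(2)] bnH image_Int[OF inj(1)]
      by (rule h_Int[OF bm_sub bm_sub])
  qed simp
  moreover obtain \<A> :: "nat set set" where \<A>: "uncountable \<A>" "\<forall>A\<in>\<A>. infinite A"
    "pairwise (\<lambda>A B. finite (A \<inter> B)) \<A>" "\<forall>A\<in>\<A>. positive m (bm ` A)"
  proof -
    obtain \<D> :: "nat set set" where \<D>: "uncountable \<D>" "\<And>D. D \<in> \<D> \<Longrightarrow> infinite D"
      "pairwise (\<lambda>A B. finite (A \<inter> B)) \<D>" using almost_disjoint_family by blast
    \<comment> \<open>The lists over \<open>D\<close>. Two such sets share, up to coding, only the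
      lists of length \<open>m\<close> over the finite set \<open>D \<inter> E\<close>, yet each is
      positive because \<open>D\<close> is infinite.\<close>
    define S where "S D = bm -` {s. set s \<subseteq> D}" for D
    have pos: "positive m (bm ` S D)" if "D \<in> \<D>" for D
      unfolding S_def image_vimage_eq ran
      using positive_lists[OF \<D>(2)[OF that], of m] by (rule positive_mono) simp
    then have inf: "infinite (S D)" if "D \<in> \<D>" for D
      using that finite_imp_not_positive[OF _ m] finite_imageI by blast
    have fin: "finite (S D \<inter> S E)" if "D \<in> \<D>" "E \<in> \<D>" "D \<noteq> E" for D E
    proof -
      have "finite (D \<inter> E)" using \<D>(3) that by (auto simp: pairwise_def)
      then have "finite {s. set s \<subseteq> D \<inter> E \<and> length s = m}" by (rule finite_lists_length_eq)
      then have "finite (bm -` {s. set s \<subseteq> D \<inter> E \<and> length s = m})" using inj(1) by (rule finite_vimageI)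
      moreover have "S D \<inter> S E = bm -` {s. set s \<subseteq> D \<inter> E \<and> length s = m}" using ran by (auto simp: S_def)
      ultimately show ?thesis by simp
    qed
    have "inj_on S \<D>"
    proof (rule inj_onI, rule ccontr)
      fix D E assume "D \<in> \<D>" "E \<in> \<D>" "S D = S E" "D \<noteq> E"
      then show False using inf[of D] fin[of D E] by simp
    qed
    then have "uncountable (S ` \<D>)" using \<D>(1) by (simp add: countable_image_inj_eq)
    moreover have "pairwise (\<lambda>A B. finite (A \<inter> B)) (S ` \<D>)"
    proof (rule pairwiseI)
      fix A C assume "A \<in> S ` \<D>" "C \<in> S ` \<D>" "A \<noteq> C"
      then obtain D E where "D \<in> \<D>" "E \<in> \<D>" "A = S D" "C = S E" "D \<noteq> E" by blast
      then show "finite (A \<inter> C)" using fin by simp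
    qed
    ultimately show thesis using that[of "S ` \<D>"] inf pos by simp
  qed
  ultimately have "\<exists>A\<in>\<A>. \<exists>(k :: nat) P. A = (\<Union>i<k. P i) \<and>
      (\<forall>i<k. \<exists>F. continuous_map (powerset_topology (P i)) (powerset_topology UNIV) F \<and>
         (\<forall>X. X \<subseteq> P i \<longrightarrow> sym_diff (F X) (H X) \<in> I))"
    using AT unfolding axiom_AT_def by simp
  then obtain A k P where A: "A \<in> \<A>" "A = (\<Union>i<(k :: nat). P i)"
    and cont: "\<And>i. i < k \<Longrightarrow> \<exists>F. continuous_map (powerset_topology (P i)) (powerset_topology UNIV) F \<and>
         (\<forall>X. X \<subseteq> P i \<longrightarrow> sym_diff (F X) (H X) \<in> I)" by auto
  have "positive m (\<Union>i<k. bm ` P i)" using \<A>(4) A by (metis image_UN)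
  then obtain i where i: "i < k" "positive m (bm ` P i)" using positive_UN by blast
  obtain F where F: "continuous_map (powerset_topology (P i)) (powerset_topology UNIV) F"
    "\<And>X. X \<subseteq> P i \<Longrightarrow> sym_diff (F X) (H X) \<in> I" using cont[OF i(1)] by blast
  \<comment> \<open>\<open>F X\<close> and \<open>H X\<close> differ by a set in \<open>I\<close>,
    and \<open>h\<close> preserves and reflects positivity.\<close>
  have "positive n (bn ` F X) \<longleftrightarrow> positive m (bm ` X)" if "X \<subseteq> P i" for X
  proof -
    have "\<not> positive n (sym_diff (bn ` F X) (bn ` H X))"
      using F(2)[OF that] unfolding I_def mem_Collect_eq sym[OF inj(2)] .
    then have "positive n (bn ` F X) \<longleftrightarrow> positive n (bn ` H X)" by (rule positive_sym_diff)
    then show ?thesis unfolding bnH h_pos[OF bm_sub] .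
  qed
  then have "(limsup_class m :: (nat \<Rightarrow> bool) set set) \<subseteq> limsup_class n"
    by (rule continuous_reduction_imp_limsup_class_subset[OF bm bn i(2) F(1)])
  then show False using limsup_class_strict[OF mn] by blast
qed

subsection \<open>The quotient algebras\<close>

lemma ideal_equiv_small_iff:
  "(X, Y) \<in> ideal_equiv {s. length s = k} (small_ideal k) \<longleftrightarrow>
     X \<subseteq> {s. length s = k} \<and> Y \<subseteq> {s. length s = k} \<and> \<not> positive k (sym_diff X Y)"
  by (auto simp: ideal_equiv_def small_ideal_iff)

lemma equiv_ideal_equiv_small:
  "equiv (Pow {s. length s = k}) (ideal_equiv {s. length s = k} (small_ideal k))"
proof (rule equivI)
  show "ideal_equiv {s. length s = k} (small_ideal k) \<subseteq> Pow {s. length s = k} \<times> Pow {s. length s = k}"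
    by (auto simp: ideal_equiv_def)
  show "refl_on (Pow {s. length s = k}) (ideal_equiv {s. length s = k} (small_ideal k))"
    by (auto simp: refl_on_def ideal_equiv_small_iff)
  show "Relation.sym (ideal_equiv {s. length s = k} (small_ideal k))"
    by (rule symI) (simp add: ideal_equiv_small_iff Un_commute)
  show "Relation.trans (ideal_equiv {s. length s = k} (small_ideal k))"
  proof (rule transI)
    fix X Y Z assume *: "(X, Y) \<in> ideal_equiv {s. length s = k} (small_ideal k)"
      "(Y, Z) \<in> ideal_equiv {s. length s = k} (small_ideal k)"
    then have "\<not> positive k (sym_diff X Y \<union> sym_diff Y Z)"
      by (simp only: ideal_equiv_small_iff positive_Un simp_thms)
    then have "\<not> positive k (sym_diff X Z)"
      using positive_mono[of k "sym_diff X Z" "sym_diff X Y \<union> sym_diff Y Z"] by blast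
    then show "(X, Z) \<in> ideal_equiv {s. length s = k} (small_ideal k)"
      using * by (simp only: ideal_equiv_small_iff simp_thms)
  qed
qed

text \<open>The union over all representatives in the definition of the meet collapses to one class
  because intersection respects the congruence.\<close>

lemma bmeet_ord_balg:
  fixes k X Y
  defines "E \<equiv> ideal_equiv {s. length s = k} (small_ideal k)"
  assumes X: "X \<subseteq> {s. length s = k}" and Y: "Y \<subseteq> {s. length s = k}"
  shows "bmeet (ord_balg k) (E `` {X}) (E `` {Y}) = E `` {X \<inter> Y}"
proof -
  have eq: "equiv (Pow {s. length s = k}) E" unfolding E_def by (rule equiv_ideal_equiv_small)
  have "E `` {X' \<inter> Y'} = E `` {X \<inter> Y}" if "(X, X') \<in> E" "(Y, Y') \<in> E" for X' Y'
  proof -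
    have "\<not> positive k (sym_diff X X' \<union> sym_diff Y Y')"
      using that by (simp only: E_def ideal_equiv_small_iff positive_Un simp_thms)
    then have "\<not> positive k (sym_diff (X \<inter> Y) (X' \<inter> Y'))"
      using positive_mono[of k "sym_diff (X \<inter> Y) (X' \<inter> Y')" "sym_diff X X' \<union> sym_diff Y Y'"] by blast
    then have "(X \<inter> Y, X' \<inter> Y') \<in> E" using that by (auto simp: E_def ideal_equiv_small_iff)
    then show ?thesis using equiv_class_eq[OF eq] by blast
  qed
  moreover have "X \<in> E `` {X}" "Y \<in> E `` {Y}" using equiv_class_self[OF eq] X Y by auto
  ultimately have "(\<Union>X'\<in>E `` {X}. \<Union>Y'\<in>E `` {Y}. E `` {X' \<inter> Y'}) = E `` {X \<inter> Y}" by blast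
  then show ?thesis
    by (simp add: ord_balg_def power_quotient_def Let_def Field_omega_pow E_def)
qed

text \<open>A choice of representatives \<open>h\<close> turns \<open>f\<close> into a lifting. This
  form covers subalgebra embeddings as well as isomorphisms and their inverses.\<close>

lemma no_meet_embedding:
  assumes AT: axiom_AT and mn: "n < m" and n: "n \<ge> 1"
    and f: "f \<in> bcarrier (ord_balg m) \<rightarrow> bcarrier (ord_balg n)"
    and inj: "inj_on f (bcarrier (ord_balg m))"
    and meet: "\<And>x y. x \<in> bcarrier (ord_balg m) \<Longrightarrow> y \<in> bcarrier (ord_balg m) \<Longrightarrow>
        f (bmeet (ord_balg m) x y) = bmeet (ord_balg n) (f x) (f y)"
    and zero: "f (bzero (ord_balg m)) = bzero (ord_balg n)"
  shows False
proof -
  define E where "E k = ideal_equiv {s :: nat list. length s = k} (small_ideal k)" for k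
  have carrier: "bcarrier (ord_balg k) = Pow {s. length s = k} // E k" for k
    by (simp add: ord_balg_def power_quotient_def Let_def Field_omega_pow E_def)
  have bzero: "bzero (ord_balg k) = E k `` {{}}" for k
    by (simp add: ord_balg_def power_quotient_def Let_def Field_omega_pow E_def)
  have eq: "equiv (Pow {s. length s = k}) (E k)" for k unfolding E_def by (rule equiv_ideal_equiv_small)
  have class_eq: "E k `` {X} = E k `` {Y} \<longleftrightarrow> \<not> positive k (sym_diff X Y)"
    if "X \<subseteq> {s. length s = k}" "Y \<subseteq> {s. length s = k}" for k X Y
    using eq_equiv_class_iff[OF eq, of X k Y] that by (simp add: E_def ideal_equiv_small_iff)
  have in_carrier: "E k `` {X} \<in> bcarrier (ord_balg k)" if "X \<subseteq> {s. length s = k}" for k X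
    unfolding carrier using that by (auto intro: quotientI)
  have "\<exists>Y. X \<subseteq> {s. length s = m} \<longrightarrow> Y \<subseteq> {s. length s = n} \<and> f (E m `` {X}) = E n `` {Y}" for X
  proof (cases "X \<subseteq> {s. length s = m}")
    case True
    then have "f (E m `` {X}) \<in> Pow {s. length s = n} // E n"
      using f in_carrier unfolding carrier[of n, symmetric] by blast
    then show ?thesis by (auto elim!: quotientE)
  qed simp
  then obtain h where h: "\<And>X. X \<subseteq> {s. length s = m} \<Longrightarrow>
      h X \<subseteq> {s. length s = n} \<and> f (E m `` {X}) = E n `` {h X}" by metis
  show False
  proof (rule no_lifting_of_embedding[OF AT mn n, of h])
    fix X :: "nat list set" assume X: "X \<subseteq> {s. length s = m}"
    show "h X \<subseteq> {s. length s = n}" using h[OF X] by simp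
    \<comment> \<open>A set is non-positive exactly when its class is zero, and injectivity makes
      \<open>f\<close> reflect zero.\<close>
    have "\<not> positive n (h X) \<longleftrightarrow> f (E m `` {X}) = f (bzero (ord_balg m))"
      using class_eq[of "h X" n "{}"] h[OF X] by (simp add: zero[unfolded bzero] bzero)
    also have "\<dots> \<longleftrightarrow> E m `` {X} = E m `` {{}}"
      using inj_on_eq_iff[OF inj in_carrier[OF X] in_carrier[of "{}" m]] by (simp add: bzero)
    also have "\<dots> \<longleftrightarrow> \<not> positive m X" using class_eq[of X m "{}"] X by simp
    finally show "positive n (h X) \<longleftrightarrow> positive m X" by simp
  next
    fix X Y :: "nat list set" assume X: "X \<subseteq> {s. length s = m}" and Y: "Y \<subseteq> {s. length s = m}"
    have XY: "X \<inter> Y \<subseteq> {s. length s = m}" using X by blast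
    show "\<not> positive n (sym_diff (h X) (h Y))" if "finite (sym_diff X Y)"
    proof -
      have "\<not> positive m (sym_diff X Y)" using finite_imp_not_positive[OF that] mn by simp
      then have "E m `` {X} = E m `` {Y}" using class_eq[OF X Y] by simp
      then have "E n `` {h X} = E n `` {h Y}" using h[OF X] h[OF Y] by simp
      then show ?thesis using class_eq[of "h X" n "h Y"] h[OF X] h[OF Y] by simp
    qed
    have "E n `` {h (X \<inter> Y)} = f (bmeet (ord_balg m) (E m `` {X}) (E m `` {Y}))"
      using h[OF XY] bmeet_ord_balg[OF X Y] by (simp add: E_def)
    also have "\<dots> = bmeet (ord_balg n) (E n `` {h X}) (E n `` {h Y})"
      using meet[OF in_carrier[OF X] in_carrier[OF Y]] h[OF X] h[OF Y] by simp
    also have "\<dots> = E n `` {h X \<inter> h Y}"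
      using h[OF X] h[OF Y] unfolding E_def by (intro bmeet_ord_balg) simp_all
    finally show "\<not> positive n (sym_diff (h (X \<inter> Y)) (h X \<inter> h Y))"
      using class_eq[of "h (X \<inter> Y)" n "h X \<inter> h Y"] h[OF X] h[OF XY] by (simp add: le_infI1)
  qed
qed

lemma bmeet_in_carrier:
  assumes "x \<in> bcarrier (ord_balg k)" "y \<in> bcarrier (ord_balg k)"
  shows "bmeet (ord_balg k) x y \<in> bcarrier (ord_balg k)"
proof -
  have c: "bcarrier (ord_balg k) = Pow {s. length s = k} // ideal_equiv {s. length s = k} (small_ideal k)"
    by (simp add: ord_balg_def power_quotient_def Let_def Field_omega_pow)
  obtain X Y where X: "X \<subseteq> {s. length s = k}" "x = ideal_equiv {s. length s = k} (small_ideal k) `` {X}"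
    and Y: "Y \<subseteq> {s. length s = k}" "y = ideal_equiv {s. length s = k} (small_ideal k) `` {Y}"
    using assms unfolding c by (auto elim!: quotientE)
  show ?thesis
    unfolding X(2) Y(2) bmeet_ord_balg[OF X(1) Y(1)] c using X(1) by (auto intro: quotientI)
qed

lemma not_isomorphic_greater:
  assumes AT: axiom_AT and mn: "n < m" and n: "n \<ge> 1"
  shows "\<not> balg_isomorphic (ord_balg m) (ord_balg n)" "\<not> balg_isomorphic (ord_balg n) (ord_balg m)"
    "\<not> balg_isomorphic_to_subalgebra (ord_balg m) (ord_balg n)"
proof -
  show "\<not> balg_isomorphic_to_subalgebra (ord_balg m) (ord_balg n)"
  proof
    assume "balg_isomorphic_to_subalgebra (ord_balg m) (ord_balg n)"
    then obtain S f where S: "S \<subseteq> bcarrier (ord_balg n)" and f: "bij_betw f (bcarrier (ord_balg m)) S"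
      and meet: "\<And>x y. x \<in> bcarrier (ord_balg m) \<Longrightarrow> y \<in> bcarrier (ord_balg m) \<Longrightarrow>
        f (bmeet (ord_balg m) x y) = bmeet (ord_balg n) (f x) (f y)"
      and zero: "f (bzero (ord_balg m)) = bzero (ord_balg n)"
      unfolding balg_isomorphic_to_subalgebra_def balg_isomorphic_def balg_subuniverse_def by auto
    have "f \<in> bcarrier (ord_balg m) \<rightarrow> bcarrier (ord_balg n)"
      using S bij_betw_imp_surj_on[OF f] by blast
    then show False
      using no_meet_embedding[OF AT mn n _ bij_betw_imp_inj_on[OF f] meet zero] by blast
  qed
  show "\<not> balg_isomorphic (ord_balg m) (ord_balg n)"
  proof
    assume "balg_isomorphic (ord_balg m) (ord_balg n)"
    then obtain f where f: "bij_betw f (bcarrier (ord_balg m)) (bcarrier (ord_balg n))"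
      and meet: "\<And>x y. x \<in> bcarrier (ord_balg m) \<Longrightarrow> y \<in> bcarrier (ord_balg m) \<Longrightarrow>
        f (bmeet (ord_balg m) x y) = bmeet (ord_balg n) (f x) (f y)"
      and zero: "f (bzero (ord_balg m)) = bzero (ord_balg n)"
      unfolding balg_isomorphic_def by auto
    show False
      using no_meet_embedding[OF AT mn n bij_betw_imp_funcset[OF f] bij_betw_imp_inj_on[OF f] meet zero] by blast
  qed
  show "\<not> balg_isomorphic (ord_balg n) (ord_balg m)"
  proof
    assume "balg_isomorphic (ord_balg n) (ord_balg m)"
    then obtain f where f: "bij_betw f (bcarrier (ord_balg n)) (bcarrier (ord_balg m))"
      and meet: "\<And>x y. x \<in> bcarrier (ord_balg n) \<Longrightarrow> y \<in> bcarrier (ord_balg n) \<Longrightarrow>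
        f (bmeet (ord_balg n) x y) = bmeet (ord_balg m) (f x) (f y)"
      and zero: "f (bzero (ord_balg n)) = bzero (ord_balg m)"
      unfolding balg_isomorphic_def by auto
    \<comment> \<open>The hypothesis gives a map from the smaller algebra to the larger one. Its
      inverse runs in the excluded direction and again preserves meets and zero.\<close>
    define g where "g = inv_into (bcarrier (ord_balg n)) f"
    have g: "bij_betw g (bcarrier (ord_balg m)) (bcarrier (ord_balg n))"
      unfolding g_def using f by (rule bij_betw_inv_into)
    have fg: "f (g x) = x" "g x \<in> bcarrier (ord_balg n)" if "x \<in> bcarrier (ord_balg m)" for x
      using that f g bij_betw_inv_into_right bij_betwE unfolding g_def by metis+
    have gf: "g (f x) = x" if "x \<in> bcarrier (ord_balg n)" for x
      unfolding g_def using f that by (rule bij_betw_inv_into_left)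
    have "g (bmeet (ord_balg m) x y) = bmeet (ord_balg n) (g x) (g y)"
      if "x \<in> bcarrier (ord_balg m)" "y \<in> bcarrier (ord_balg m)" for x y
      using meet[OF fg(2)[OF that(1)] fg(2)[OF that(2)]] fg[OF that(1)] fg[OF that(2)]
        gf[OF bmeet_in_carrier[of "g x" n "g y"]] by simp
    moreover have "bzero (ord_balg n) \<in> bcarrier (ord_balg n)"
      by (auto simp: ord_balg_def power_quotient_def Let_def intro: quotientI)
    then have "g (bzero (ord_balg m)) = bzero (ord_balg n)" using gf zero by metis
    ultimately show False
      using no_meet_embedding[OF AT mn n bij_betw_imp_funcset[OF g] bij_betw_imp_inj_on[OF g]] by blast
  qed
qed

theorem theorem6p4:
  assumes AT: axiom_AT
  shows "(\<forall>m n. 1 \<le> m \<and> 1 \<le> n \<and> m \<noteq> n \<longrightarrow> \<not> balg_isomorphic (ord_balg m) (ord_balg n)) \<and>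
         (\<forall>m n. m > n \<and> n \<ge> 1 \<longrightarrow> \<not> balg_isomorphic_to_subalgebra (ord_balg m) (ord_balg n))"
  using not_isomorphic_greater[OF AT] by (metis linorder_neqE_nat)

end
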